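(* Let $A$ and $B$ be separable simple unital $C^*$-algebras and assume that there exists a unital tracially sequentially-split $*$-homomorphism $\phi:A\to B$. If $B$ is finite, then $A$ is finite; and if $B$ has stable rank one, then $A$ has stable rank one.
   Context: For a $C^*$-algebra $A$, let $A^+$ be its cone of positive elements (including $0$), $c_0(\mathbb{N},A)=\{(a_n)_n: \lim_n\|a_n\|=0\}$, $l^\infty(\mathbb{N},A)=\{(a_n)_n: (\|a_n\|)_n \text{ bounded}\}$, and $A_\infty=l^\infty(\mathbb{N},A)/c_0(\mathbb{N},A)$. $A$ is embedded in $A_\infty$ as constant sequences, and $A_\infty\cap A'$ is the central sequence algebra. Let $A_\infty^{++}$ be the set of $x\in A_\infty^+$, $x=[(x_n)_n]$, for which there is no strictly increasing sequence $(k_n)$ of natural numbers with $\lim_n x_{k_n}=0$. Definition. Let $A,B$ be separable $C^*$-algebras with $A$ unital. A $*$-homomorphism $\phi:A\to B$ is tracially sequentially-split if for every nonzero $z\in A_\infty^{++}$ there exist a $*$-homomorphism $\psi:B\to A_\infty$ and a nonzero projection $g\in A_\infty\cap A'$ such that (1) $\psi(\phi(a))=ag$ for each $a\in A$, and (2) $1_{A_\infty}-g$ is Murray-von Neumann equivalent in $A_\infty$ to a projection in the hereditary $C^*$-subalgebra $\overline{zA_\infty z}$. A unital $C^*$-algebra is finite if every isometry in it is a unitary; it has stable rank one if its invertible elements are dense. *)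

theory Defs
  imports "HOL-Analysis.Analysis"
begin

section \<open>C*-algebras\<close>

class cstar_algebra = real_normed_algebra + banach +
  fixes scaleC :: "complex \<Rightarrow> 'a \<Rightarrow> 'a" (infixr \<open>*\<^sub>C\<close> 75)
    and star :: "'a \<Rightarrow> 'a" (\<open>(_\<^sup>\<star>)\<close> [1000] 999)
  assumes scaleC_add_right: "c *\<^sub>C (x + y) = c *\<^sub>C x + c *\<^sub>C y"
    and scaleC_add_left: "(c + d) *\<^sub>C x = c *\<^sub>C x + d *\<^sub>C x"
    and scaleC_scaleC: "c *\<^sub>C (d *\<^sub>C x) = (c * d) *\<^sub>C x"
    and scaleR_scaleC: "r *\<^sub>R x = complex_of_real r *\<^sub>C x"
    and mult_scaleC_left: "(c *\<^sub>C x) * y = c *\<^sub>C (x * y)"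
    and mult_scaleC_right: "x * (c *\<^sub>C y) = c *\<^sub>C (x * y)"
    and norm_scaleC: "norm (c *\<^sub>C x) = cmod c * norm x"
    and star_star: "(x\<^sup>\<star>)\<^sup>\<star> = x"
    and star_add: "(x + y)\<^sup>\<star> = x\<^sup>\<star> + y\<^sup>\<star>"
    and star_scaleC: "(c *\<^sub>C x)\<^sup>\<star> = cnj c *\<^sub>C x\<^sup>\<star>"
    and star_mult: "(x * y)\<^sup>\<star> = y\<^sup>\<star> * x\<^sup>\<star>"
    and cstar_identity: "norm (x\<^sup>\<star> * x) = (norm x)\<^sup>2"

text \<open>Unital C*-algebras are nonzero here (the class includes \<open>0 \<noteq> 1\<close>).\<close>

class unital_cstar_algebra = cstar_algebra + real_normed_algebra_1

lemma star_zero [simp]: "(0::'a::cstar_algebra)\<^sup>\<star> = 0"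
  using star_add[of "0::'a" 0] by simp

lemma star_diff: "((x::'a::cstar_algebra) - y)\<^sup>\<star> = x\<^sup>\<star> - y\<^sup>\<star>"
  using star_add[of "x - y" y] by (simp add: algebra_simps)

lemma norm_star [simp]: "norm ((x::'a::cstar_algebra)\<^sup>\<star>) = norm x"
proof -
  have le: "norm y \<le> norm (y\<^sup>\<star>)" for y :: 'a
  proof (cases "norm y = 0")
    case False
    have "norm y * norm y \<le> norm (y\<^sup>\<star>) * norm y"
      using norm_mult_ineq[of "y\<^sup>\<star>" y] by (simp add: cstar_identity power2_eq_square)
    then show ?thesis using False by simp
  qed simp
  show ?thesis using le[of x] le[of "x\<^sup>\<star>"] by (simp add: star_star)
qed

section \<open>The sequence algebra\<close>

definition l_infty :: "(nat \<Rightarrow> 'a::cstar_algebra) set" where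
  "l_infty = {X. bounded (range (\<lambda>n. norm (X n)))}"

definition c_zero :: "(nat \<Rightarrow> 'a::cstar_algebra) set" where
  "c_zero = {X. (\<lambda>n. norm (X n)) \<longlonglongrightarrow> 0}"

definition ainf_rel :: "(nat \<Rightarrow> 'a::cstar_algebra) \<Rightarrow> (nat \<Rightarrow> 'a) \<Rightarrow> bool" where
  "ainf_rel X Y \<longleftrightarrow> X \<in> l_infty \<and> Y \<in> l_infty \<and> (\<lambda>n. X n - Y n) \<in> c_zero"

lemma l_infty_iff: "X \<in> l_infty \<longleftrightarrow> (\<exists>K. \<forall>n. norm (X n) \<le> K)"
  by (simp add: l_infty_def bounded_iff)

lemma l_inftyI: "(\<And>n. norm (X n) \<le> K) \<Longrightarrow> X \<in> l_infty"
  by (auto simp: l_infty_iff)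

lemma c_zero_iff: "X \<in> c_zero \<longleftrightarrow> X \<longlonglongrightarrow> 0"
  by (simp add: c_zero_def tendsto_norm_zero_iff)

lemma l_infty_const [simp]: "(\<lambda>n. a) \<in> l_infty"
  by (auto simp: l_infty_iff)

lemma l_infty_add: "X \<in> l_infty \<Longrightarrow> Y \<in> l_infty \<Longrightarrow> (\<lambda>n. X n + Y n) \<in> l_infty"
proof -
  assume "X \<in> l_infty" "Y \<in> l_infty"
  then obtain K L where "\<And>n. norm (X n) \<le> K" "\<And>n. norm (Y n) \<le> L" by (auto simp: l_infty_iff)
  then show ?thesis by (intro l_inftyI[of _ "K + L"] norm_triangle_le add_mono) auto
qed

lemma l_infty_mult: "X \<in> l_infty \<Longrightarrow> Y \<in> l_infty \<Longrightarrow> (\<lambda>n. X n * Y n) \<in> l_infty"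
proof -
  assume "X \<in> l_infty" "Y \<in> l_infty"
  then obtain K L where KL: "\<And>n. norm (X n) \<le> K" "\<And>n. norm (Y n) \<le> L" by (auto simp: l_infty_iff)
  have "norm (X n * Y n) \<le> K * L" for n
    using KL norm_mult_ineq[of "X n" "Y n"] mult_mono'[OF KL(1)[of n] KL(2)[of n]] by fastforce
  then show ?thesis by (rule l_inftyI)
qed

lemma l_infty_uminus: "X \<in> l_infty \<Longrightarrow> (\<lambda>n. - X n) \<in> l_infty"
  by (auto simp: l_infty_iff)

lemma l_infty_diff: "X \<in> l_infty \<Longrightarrow> Y \<in> l_infty \<Longrightarrow> (\<lambda>n. X n - Y n) \<in> l_infty"
  using l_infty_add[of X "\<lambda>n. - Y n"] l_infty_uminus[of Y] by simp

lemma l_infty_star: "X \<in> l_infty \<Longrightarrow> (\<lambda>n. (X n)\<^sup>\<star>) \<in> l_infty"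
  by (auto simp: l_infty_iff)

lemma l_infty_scaleC: "X \<in> l_infty \<Longrightarrow> (\<lambda>n. c *\<^sub>C X n) \<in> l_infty"
  by (auto simp: l_infty_iff norm_scaleC) (meson mult_left_mono norm_ge_zero)

lemma l_infty_scaleR: "X \<in> l_infty \<Longrightarrow> (\<lambda>n. c *\<^sub>R X n) \<in> l_infty"
  by (simp add: scaleR_scaleC l_infty_scaleC)

lemma c_zero_mult_left:
  assumes "X \<in> l_infty" "Y \<in> c_zero"
  shows "(\<lambda>n. X n * Y n) \<in> c_zero"
proof -
  obtain K where "\<And>n. norm (X n) \<le> K" using assms by (auto simp: l_infty_iff)
  then have "Bseq X" by (rule BseqI')
  then show ?thesis
    using assms bounded_bilinear.Bfun_prod_Zfun[OF bounded_bilinear_mult, of X sequentially Y]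
    by (simp add: c_zero_iff tendsto_Zfun_iff)
qed

lemma c_zero_mult_right:
  assumes "X \<in> c_zero" "Y \<in> l_infty"
  shows "(\<lambda>n. X n * Y n) \<in> c_zero"
proof -
  obtain K where "\<And>n. norm (Y n) \<le> K" using assms by (auto simp: l_infty_iff)
  then have "Bseq Y" by (rule BseqI')
  then show ?thesis
    using assms bounded_bilinear.Zfun_prod_Bfun[OF bounded_bilinear_mult, of X sequentially Y]
    by (simp add: c_zero_iff tendsto_Zfun_iff)
qed

lemma c_zero_add: "X \<in> c_zero \<Longrightarrow> Y \<in> c_zero \<Longrightarrow> (\<lambda>n. X n + Y n) \<in> c_zero"
  using tendsto_add[of X 0 sequentially Y 0] by (simp add: c_zero_iff)

lemma c_zero_uminus: "X \<in> c_zero \<Longrightarrow> (\<lambda>n. - X n) \<in> c_zero"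
  by (simp add: c_zero_def)

lemma c_zero_star: "X \<in> c_zero \<Longrightarrow> (\<lambda>n. (X n)\<^sup>\<star>) \<in> c_zero"
  by (simp add: c_zero_def)

lemma c_zero_scaleC: "X \<in> c_zero \<Longrightarrow> (\<lambda>n. c *\<^sub>C X n) \<in> c_zero"
  using tendsto_mult_left[of "\<lambda>n. norm (X n)" 0 sequentially "cmod c"]
  by (simp add: c_zero_def norm_scaleC)

lemma part_equivp_ainf_rel: "part_equivp (ainf_rel :: (nat \<Rightarrow> 'a::cstar_algebra) \<Rightarrow> _)"
proof (rule part_equivpI)
  show "\<exists>X :: nat \<Rightarrow> 'a. ainf_rel X X"
    by (rule exI[of _ "\<lambda>n. 0"]) (simp add: ainf_rel_def c_zero_iff)
  show "symp (ainf_rel :: (nat \<Rightarrow> 'a) \<Rightarrow> _)"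
  proof (rule sympI)
    fix X Y :: "nat \<Rightarrow> 'a" assume "ainf_rel X Y"
    then show "ainf_rel Y X"
      using c_zero_uminus[of "\<lambda>n. X n - Y n"] by (auto simp: ainf_rel_def)
  qed
  show "transp (ainf_rel :: (nat \<Rightarrow> 'a) \<Rightarrow> _)"
  proof (rule transpI)
    fix X Y Z :: "nat \<Rightarrow> 'a" assume "ainf_rel X Y" "ainf_rel Y Z"
    then show "ainf_rel X Z"
      using c_zero_add[of "\<lambda>n. X n - Y n" "\<lambda>n. Y n - Z n"] by (simp add: ainf_rel_def)
  qed
qed

quotient_type (overloaded) 'a ainf = "nat \<Rightarrow> 'a::cstar_algebra" / partial: ainf_rel
  morphisms rep_ainf Ainf
  by (rule part_equivp_ainf_rel)

text \<open>\<^term>\<open>Ainf X\<close> is the class \<open>[X]\<close>, meaningful only for \<^term>\<open>X \<in> l_infty\<close>.\<close>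

lemma Ainf_cases:
  obtains X where "X \<in> l_infty" "x = Ainf X"
  using Quotient_abs_rep[OF Quotient_ainf, of x] Quotient_rep_reflp[OF Quotient_ainf, of x]
  by (metis ainf_rel_def)

lemma Ainf_eq_iff:
  "X \<in> l_infty \<Longrightarrow> Y \<in> l_infty \<Longrightarrow> Ainf X = Ainf Y \<longleftrightarrow> (\<lambda>n. X n - Y n) \<in> c_zero"
  using Quotient_rel[OF Quotient_ainf, of X Y] by (auto simp: ainf_rel_def c_zero_iff)

lemma Ainf_eqI:
  "X \<in> l_infty \<Longrightarrow> Y \<in> l_infty \<Longrightarrow> (\<And>n. X n = Y n) \<Longrightarrow> Ainf X = Ainf Y"
  by (simp add: Ainf_eq_iff c_zero_iff)

instantiation ainf :: (cstar_algebra) "{zero, plus, minus, uminus, times, scaleR}"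
begin

lift_definition zero_ainf :: "'a ainf" is "\<lambda>n. 0"
  by (simp add: ainf_rel_def c_zero_iff)

lift_definition plus_ainf :: "'a ainf \<Rightarrow> 'a ainf \<Rightarrow> 'a ainf" is "\<lambda>X Y n. X n + Y n"
proof -
  fix X X' Y Y' :: "nat \<Rightarrow> 'a"
  assume a: "ainf_rel X X'" "ainf_rel Y Y'"
  have "(\<lambda>n. (X n - X' n) + (Y n - Y' n)) \<in> c_zero"
    using a by (intro c_zero_add) (auto simp: ainf_rel_def)
  then show "ainf_rel (\<lambda>n. X n + Y n) (\<lambda>n. X' n + Y' n)"
    using a by (auto simp: ainf_rel_def add_diff_add intro!: l_infty_add)
qed

lift_definition uminus_ainf :: "'a ainf \<Rightarrow> 'a ainf" is "\<lambda>X n. - X n"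
proof -
  fix X Y :: "nat \<Rightarrow> 'a" assume "ainf_rel X Y"
  then show "ainf_rel (\<lambda>n. - X n) (\<lambda>n. - Y n)"
    using c_zero_uminus[of "\<lambda>n. X n - Y n"]
    by (auto simp: ainf_rel_def algebra_simps intro!: l_infty_uminus)
qed

lift_definition minus_ainf :: "'a ainf \<Rightarrow> 'a ainf \<Rightarrow> 'a ainf" is "\<lambda>X Y n. X n - Y n"
proof -
  fix X X' Y Y' :: "nat \<Rightarrow> 'a"
  assume a: "ainf_rel X X'" "ainf_rel Y Y'"
  have "(\<lambda>n. (X n - X' n) + - (Y n - Y' n)) \<in> c_zero"
    using a by (intro c_zero_add c_zero_uminus) (auto simp: ainf_rel_def)
  then show "ainf_rel (\<lambda>n. X n - Y n) (\<lambda>n. X' n - Y' n)"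
    using a by (auto simp: ainf_rel_def algebra_simps intro!: l_infty_diff)
qed

lift_definition times_ainf :: "'a ainf \<Rightarrow> 'a ainf \<Rightarrow> 'a ainf" is "\<lambda>X Y n. X n * Y n"
proof -
  fix X X' Y Y' :: "nat \<Rightarrow> 'a"
  assume a: "ainf_rel X X'" "ainf_rel Y Y'"
  have "(\<lambda>n. X n * (Y n - Y' n) + (X n - X' n) * Y' n) \<in> c_zero"
    using a by (intro c_zero_add c_zero_mult_left c_zero_mult_right) (auto simp: ainf_rel_def)
  then show "ainf_rel (\<lambda>n. X n * Y n) (\<lambda>n. X' n * Y' n)"
    using a by (auto simp: ainf_rel_def algebra_simps intro!: l_infty_mult)
qed

lift_definition scaleR_ainf :: "real \<Rightarrow> 'a ainf \<Rightarrow> 'a ainf" is "\<lambda>r X n. r *\<^sub>R X n"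
proof -
  fix r and X Y :: "nat \<Rightarrow> 'a" assume "ainf_rel X Y"
  then show "ainf_rel (\<lambda>n. r *\<^sub>R X n) (\<lambda>n. r *\<^sub>R Y n)"
    using c_zero_scaleC[of "\<lambda>n. X n - Y n" "complex_of_real r"]
    by (auto simp: ainf_rel_def l_infty_scaleR scaleR_diff_right simp flip: scaleR_scaleC)
qed

instance ..

end

lemma Ainf_add: "X \<in> l_infty \<Longrightarrow> Y \<in> l_infty \<Longrightarrow> Ainf X + Ainf Y = Ainf (\<lambda>n. X n + Y n)"
  by (rule plus_ainf.abs_eq) (auto simp: eq_onp_def ainf_rel_def c_zero_iff)

lemma Ainf_diff: "X \<in> l_infty \<Longrightarrow> Y \<in> l_infty \<Longrightarrow> Ainf X - Ainf Y = Ainf (\<lambda>n. X n - Y n)"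
  by (rule minus_ainf.abs_eq) (auto simp: eq_onp_def ainf_rel_def c_zero_iff)

lemma Ainf_uminus: "X \<in> l_infty \<Longrightarrow> - Ainf X = Ainf (\<lambda>n. - X n)"
  by (rule uminus_ainf.abs_eq) (auto simp: eq_onp_def ainf_rel_def c_zero_iff)

lemma Ainf_mult: "X \<in> l_infty \<Longrightarrow> Y \<in> l_infty \<Longrightarrow> Ainf X * Ainf Y = Ainf (\<lambda>n. X n * Y n)"
  by (rule times_ainf.abs_eq) (auto simp: eq_onp_def ainf_rel_def c_zero_iff)

lemma Ainf_scaleR: "X \<in> l_infty \<Longrightarrow> r *\<^sub>R Ainf X = Ainf (\<lambda>n. r *\<^sub>R X n)"
  by (rule scaleR_ainf.abs_eq) (auto simp: eq_onp_def ainf_rel_def c_zero_iff)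

lemma Ainf_zero: "0 = Ainf (\<lambda>n. 0)"
  by (rule zero_ainf.abs_eq)

lemmas Ainf_ops = Ainf_add Ainf_diff Ainf_uminus Ainf_mult Ainf_scaleR

lemmas l_infty_intros = l_infty_const l_infty_add l_infty_diff l_infty_uminus l_infty_mult
  l_infty_scaleR l_infty_scaleC l_infty_star

instance ainf :: (cstar_algebra) real_algebra
proof
  fix x y z :: "'a ainf" and r s :: real
  obtain X where X: "X \<in> l_infty" "x = Ainf X" by (rule Ainf_cases)
  obtain Y where Y: "Y \<in> l_infty" "y = Ainf Y" by (rule Ainf_cases)
  obtain Z where Z: "Z \<in> l_infty" "z = Ainf Z" by (rule Ainf_cases)
  note [simp] = X Y Z Ainf_ops l_infty_intros Ainf_zero
  show "x + y + z = x + (y + z)" by (simp add: algebra_simps)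
  show "x + y = y + x" by (simp add: algebra_simps)
  show "0 + x = x" by simp
  show "- x + x = 0" by simp
  show "x - y = x + - y" by simp
  show "x * y * z = x * (y * z)" by (simp add: algebra_simps)
  show "(x + y) * z = x * z + y * z" by (simp add: algebra_simps)
  show "x * (y + z) = x * y + x * z" by (simp add: algebra_simps)
  show "r *\<^sub>R (x + y) = r *\<^sub>R x + r *\<^sub>R y" by (simp add: algebra_simps)
  show "(r + s) *\<^sub>R x = r *\<^sub>R x + s *\<^sub>R x" by (simp add: algebra_simps)
  show "r *\<^sub>R s *\<^sub>R x = (r * s) *\<^sub>R x" by simp
  show "1 *\<^sub>R x = x" by simp
  show "r *\<^sub>R x * y = r *\<^sub>R (x * y)" by simp
  show "x * r *\<^sub>R y = r *\<^sub>R (x * y)" by simp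
qed

text \<open>The norm is the quotient norm for the supremum norm on \<^const>\<open>l_infty\<close>.\<close>

instantiation ainf :: (cstar_algebra) real_normed_algebra
begin

definition norm_ainf :: "'a ainf \<Rightarrow> real" where
  "norm_ainf x = (INF X\<in>{X \<in> l_infty. Ainf X = x}. SUP n. norm (X n))"

definition sgn_ainf :: "'a ainf \<Rightarrow> 'a ainf" where
  "sgn_ainf x = x /\<^sub>R norm x"

definition dist_ainf :: "'a ainf \<Rightarrow> 'a ainf \<Rightarrow> real" where
  "dist_ainf x y = norm (x - y)"

definition uniformity_ainf :: "('a ainf \<times> 'a ainf) filter" where
  "uniformity_ainf = (INF e\<in>{0<..}. principal {(x, y). dist x y < e})"

definition open_ainf :: "'a ainf set \<Rightarrow> bool" where
  "open_ainf U \<longleftrightarrow> (\<forall>x\<in>U. eventually (\<lambda>(x', y). x' = x \<longrightarrow> y \<in> U) uniformity)"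

lemma l_infty_bdd_above: "X \<in> l_infty \<Longrightarrow> bdd_above (range (\<lambda>n. norm (X n)))"
  by (auto simp: l_infty_iff)

lemma l_infty_SUP_nonneg:
  assumes "X \<in> l_infty"
  shows "0 \<le> (SUP n. norm (X n))"
  using cSUP_upper[OF _ l_infty_bdd_above[OF assms], of 0] norm_ge_zero[of "X 0"]
  by (rule order_trans[rotated]) simp_all

lemma norm_ainf_bdd_below: "bdd_below ((\<lambda>X. SUP n. norm (X n)) ` {X \<in> l_infty. Ainf X = x})"
  by (auto intro!: bdd_belowI[of _ 0] l_infty_SUP_nonneg)

lemma norm_ainf_less_rep:
  assumes "norm (x::'a::cstar_algebra ainf) < e"
  shows "\<exists>X\<in>l_infty. x = Ainf X \<and> (\<exists>r<e. \<forall>n. norm (X n) \<le> r)"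
proof -
  obtain X0 where X0: "X0 \<in> l_infty" "x = Ainf X0" by (rule Ainf_cases)
  have "\<exists>X\<in>{X \<in> l_infty. Ainf X = x}. (SUP n. norm (X n)) < e"
    using assms unfolding norm_ainf_def
    by (subst (asm) cINF_less_iff[OF _ norm_ainf_bdd_below]) (use X0 in auto)
  then obtain X where X: "X \<in> l_infty" "Ainf X = x" "(SUP n. norm (X n)) < e" by auto
  have "norm (X n) \<le> (SUP n. norm (X n))" for n
    by (rule cSUP_upper[OF _ l_infty_bdd_above[OF X(1)]]) simp
  then show ?thesis using X by blast
qed

lemma norm_Ainf_le_iff:
  fixes X :: "nat \<Rightarrow> 'a::cstar_algebra"
  assumes X: "X \<in> l_infty"
  shows "norm (Ainf X) \<le> c \<longleftrightarrow> (\<forall>e>c. \<forall>\<^sub>F n in sequentially. norm (X n) < e)"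
proof safe
  fix e assume le: "norm (Ainf X) \<le> c" and e: "c < e"
  obtain Y r where Y: "Y \<in> l_infty" "Ainf X = Ainf Y" "r < e" "\<And>n. norm (Y n) \<le> r"
    using norm_ainf_less_rep[of "Ainf X" e] le e by fastforce
  then have "(\<lambda>n. X n - Y n) \<longlonglongrightarrow> 0" using X by (simp add: Ainf_eq_iff c_zero_iff)
  then have "\<forall>\<^sub>F n in sequentially. norm (X n - Y n) < e - r"
    using Y(3) by (simp add: tendsto_iff)
  then show "\<forall>\<^sub>F n in sequentially. norm (X n) < e"
  proof eventually_elim
    case (elim n)
    then show ?case using norm_triangle_sub[of "X n" "Y n"] Y(4)[of n] by simp
  qed
next
  assume ev: "\<forall>e>c. \<forall>\<^sub>F n in sequentially. norm (X n) < e"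
  show "norm (Ainf X) \<le> c"
  proof (rule dense_ge)
    fix e assume "c < e"
    then obtain N where N: "\<And>n. n \<ge> N \<Longrightarrow> norm (X n) < e"
      using ev by (auto simp: eventually_sequentially)
    have e0: "0 < e" using N[of N] norm_ge_zero[of "X N"] by linarith
    define Y where "Y = (\<lambda>n. if n < N then 0 else X n)"
    have Ye: "norm (Y n) \<le> e" for n using N[of n] e0 by (auto simp: Y_def)
    then have Y: "Y \<in> l_infty" by (rule l_inftyI)
    have "\<forall>\<^sub>F n in sequentially. X n - Y n = 0"
      unfolding eventually_sequentially by (rule exI[of _ N]) (simp add: Y_def)
    then have "(\<lambda>n. X n - Y n) \<in> c_zero"
      by (simp add: c_zero_iff tendsto_eventually)
    then have "Ainf Y = Ainf X" using X Y Ainf_eq_iff by metis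
    then have "norm (Ainf X) \<le> (SUP n. norm (Y n))"
      unfolding norm_ainf_def using Y by (intro cINF_lower[OF norm_ainf_bdd_below]) simp
    also have "\<dots> \<le> e" by (rule cSUP_least) (use Ye in auto)
    finally show "norm (Ainf X) \<le> e" .
  qed
qed

lemma norm_Ainf_ev:
  "X \<in> l_infty \<Longrightarrow> norm (Ainf X) < e \<Longrightarrow> \<forall>\<^sub>F n in sequentially. norm (X n) < e"
  using norm_Ainf_le_iff[of X "norm (Ainf X)"] by simp

lemma norm_ainf_nonneg: "0 \<le> norm (x::'a::cstar_algebra ainf)"
proof -
  obtain X0 where "X0 \<in> l_infty" "x = Ainf X0" by (rule Ainf_cases)
  then show ?thesis unfolding norm_ainf_def
    by (intro cINF_greatest) (auto intro: l_infty_SUP_nonneg)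
qed

lemma norm_Ainf_le:
  assumes "\<And>n. norm (X n) \<le> c"
  shows "norm (Ainf X) \<le> c"
proof -
  have X: "X \<in> l_infty" using assms by (rule l_inftyI)
  have "\<forall>\<^sub>F n in sequentially. norm (X n) < e" if "c < e" for e
    by (rule always_eventually) (use assms that in \<open>blast intro: le_less_trans\<close>)
  then show ?thesis using norm_Ainf_le_iff[OF X] by blast
qed

lemma norm_ainf_scaleR_le: "norm (r *\<^sub>R (x::'a::cstar_algebra ainf)) \<le> \<bar>r\<bar> * norm x"
proof (cases "r = 0")
  case True
  have "norm (Ainf (\<lambda>n. 0 :: 'a)) \<le> 0" by (rule norm_Ainf_le) simp
  then show ?thesis using True by (simp add: Ainf_zero)
next
  case False
  obtain X where X: "X \<in> l_infty" "x = Ainf X" by (rule Ainf_cases)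
  have "\<forall>\<^sub>F n in sequentially. norm (r *\<^sub>R X n) < e" if "\<bar>r\<bar> * norm x < e" for e
  proof -
    have "norm (Ainf X) < e / \<bar>r\<bar>"
      using that False X by (simp add: pos_less_divide_eq mult.commute)
    from norm_Ainf_ev[OF X(1) this] show ?thesis
      using False by (simp add: pos_less_divide_eq mult.commute)
  qed
  then show ?thesis using X(1) unfolding X(2)
    by (subst Ainf_scaleR[OF X(1)], subst norm_Ainf_le_iff) (auto intro: l_infty_scaleR)
qed

instance
proof
  fix x y :: "'a ainf" and r :: real and U :: "'a ainf set"
  obtain X where X: "X \<in> l_infty" "x = Ainf X" by (rule Ainf_cases)
  obtain Y where Y: "Y \<in> l_infty" "y = Ainf Y" by (rule Ainf_cases)
  show "dist x y = norm (x - y)" by (rule dist_ainf_def)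
  show "sgn x = x /\<^sub>R norm x" by (rule sgn_ainf_def)
  show "uniformity = (INF e\<in>{0<..}. principal {(x, y :: 'a ainf). dist x y < e})"
    by (rule uniformity_ainf_def)
  show "open U \<longleftrightarrow> (\<forall>x\<in>U. \<forall>\<^sub>F (x', y) in uniformity. x' = x \<longrightarrow> y \<in> U)"
    by (rule open_ainf_def)
  show "norm x = 0 \<longleftrightarrow> x = 0"
  proof
    assume "norm x = 0"
    then have "\<forall>e>0. \<forall>\<^sub>F n in sequentially. norm (X n) < e" using X norm_Ainf_le_iff[of X 0] by simp
    then have "X \<longlonglongrightarrow> 0" by (simp add: tendsto_iff)
    then show "x = 0" using X by (simp add: Ainf_zero Ainf_eq_iff c_zero_iff)
  next
    assume "x = 0"
    then show "norm x = 0"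
      using norm_Ainf_le[of "\<lambda>n. 0 :: 'a" 0] norm_ainf_nonneg[of x] by (simp add: Ainf_zero)
  qed
  show "norm (x + y) \<le> norm x + norm y"
  proof -
    have "\<forall>\<^sub>F n in sequentially. norm (X n + Y n) < e" if e: "norm x + norm y < e" for e
    proof -
      define d where "d = (e - norm x - norm y) / 2"
      have "\<forall>\<^sub>F n in sequentially. norm (X n) < norm x + d" "\<forall>\<^sub>F n in sequentially. norm (Y n) < norm y + d"
        using X Y e by (auto intro!: norm_Ainf_ev simp: d_def)
      then show ?thesis
      proof eventually_elim
        case (elim n)
        then show ?case using norm_triangle_ineq[of "X n" "Y n"] by (simp add: d_def field_simps)
      qed
    qed
    then show ?thesis using X Y by (simp add: Ainf_add norm_Ainf_le_iff l_infty_intros)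
  qed
  show "norm (r *\<^sub>R x) = \<bar>r\<bar> * norm x"
  proof (rule antisym[OF norm_ainf_scaleR_le])
    show "\<bar>r\<bar> * norm x \<le> norm (r *\<^sub>R x)"
    proof (cases "r = 0")
      case False
      have "norm x \<le> \<bar>inverse r\<bar> * norm (r *\<^sub>R x)"
        using norm_ainf_scaleR_le[of "inverse r" "r *\<^sub>R x"] False by simp
      from mult_left_mono[OF this abs_ge_zero[of r]]
      show ?thesis using False by (simp add: abs_inverse flip: mult.assoc)
    qed (simp add: norm_ainf_nonneg)
  qed
  show "norm (x * y) \<le> norm x * norm y"
  proof -
    have "\<forall>\<^sub>F n in sequentially. norm (X n * Y n) < e" if e: "norm x * norm y < e" for e
    proof -
      have "((\<lambda>d. (norm x + d) * (norm y + d)) \<longlongrightarrow> (norm x + 0) * (norm y + 0)) (at_right 0)"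
        by (intro tendsto_intros)
      then have "\<forall>\<^sub>F d in at_right 0. (norm x + d) * (norm y + d) < e"
        using e by (intro order_tendstoD) auto
      moreover have "\<forall>\<^sub>F d in at_right 0. (0::real) < d" by (rule eventually_at_right_less)
      ultimately have "\<forall>\<^sub>F d in at_right 0. 0 < d \<and> (norm x + d) * (norm y + d) < e"
        by eventually_elim simp
      then obtain d where d: "0 < d" "(norm x + d) * (norm y + d) < e"
        using eventually_happens'[OF trivial_limit_at_right_real] by blast
      have "\<forall>\<^sub>F n in sequentially. norm (X n) < norm x + d" "\<forall>\<^sub>F n in sequentially. norm (Y n) < norm y + d"
        using X Y d by (auto intro!: norm_Ainf_ev)
      then show ?thesis
      proof eventually_elim
        case (elim n)
        then have "norm (X n) * norm (Y n) \<le> (norm x + d) * (norm y + d)"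
          by (intro mult_mono') auto
        then show ?case using norm_mult_ineq[of "X n" "Y n"] d by linarith
      qed
    qed
    then show ?thesis using X Y by (simp add: Ainf_mult norm_Ainf_le_iff l_infty_intros)
  qed
qed

end

instance ainf :: (cstar_algebra) banach
proof
  fix x :: "nat \<Rightarrow> 'a ainf"
  assume C: "Cauchy x"
  have "\<forall>k. \<exists>N. \<forall>m\<ge>N. \<forall>n\<ge>N. norm (x m - x n) < (1/2) ^ k"
    using C by (auto simp: Cauchy_iff)
  then obtain N where N: "\<And>k m n. m \<ge> N k \<Longrightarrow> n \<ge> N k \<Longrightarrow> norm (x m - x n) < (1/2) ^ k"
    by metis
  define r where "r k = (\<Sum>i\<le>k. N i) + k" for k
  have r_mono: "strict_mono r" by (rule strict_monoI_Suc) (simp add: r_def)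
  have rN: "r k \<ge> N k" for k
    using member_le_sum[of k "{..k}" N] by (simp add: r_def)
  have "norm (x (r (Suc k)) - x (r k)) < (1/2) ^ k" for k
    using strict_monoD[OF r_mono, of k "Suc k"] rN[of k] by (intro N) auto
  then have "\<forall>k. \<exists>D\<in>l_infty. x (r (Suc k)) - x (r k) = Ainf D \<and> (\<forall>n. norm (D n) \<le> (1/2) ^ k)"
    using norm_ainf_less_rep by (meson less_imp_le order_trans)
  then obtain D where D: "\<And>k. D k \<in> l_infty" "\<And>k. x (r (Suc k)) - x (r k) = Ainf (D k)"
      "\<And>k n. norm (D k n) \<le> (1/2) ^ k" by metis
  obtain Y where Y: "Y \<in> l_infty" "x (r 0) = Ainf Y" by (rule Ainf_cases)
  have S: "(\<lambda>n. \<Sum>k<m. D k n) \<in> l_infty" for m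
    by (induction m) (auto intro!: l_infty_intros D(1))
  have rep: "x (r m) = Ainf (\<lambda>n. Y n + (\<Sum>k<m. D k n))" for m
  proof (induction m)
    case (Suc m)
    have "x (r (Suc m)) = x (r m) + (x (r (Suc m)) - x (r m))" by simp
    also have "\<dots> = Ainf (\<lambda>n. Y n + (\<Sum>k<m. D k n)) + Ainf (D m)"
      unfolding D(2) by (simp only: Suc.IH)
    also have "\<dots> = Ainf (\<lambda>n. Y n + (\<Sum>k<Suc m. D k n))"
      using Y S D by (simp add: Ainf_add l_infty_add add.assoc)
    finally show ?case .
  qed (simp add: Y)
  have geo: "summable (\<lambda>k. (1/2 :: real) ^ (k + m))" for m
    unfolding power_add by (rule summable_mult2) (rule summable_geometric, simp)
  have smb: "summable (\<lambda>k. D (k + m) n)" for m n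
    by (rule summable_comparison_test'[OF geo[of m], of 0]) (rule D(3))
  have tail: "norm (\<Sum>k. D (k + m) n) \<le> 2 * (1/2) ^ m" for m n
  proof -
    have "norm (\<Sum>k. D (k + m) n) \<le> (\<Sum>k. (1/2 :: real) ^ (k + m))"
      by (rule norm_suminf_le[OF _ geo]) (rule D(3))
    also have "\<dots> = (\<Sum>k. (1/2 :: real) ^ k) * (1/2) ^ m"
      unfolding power_add by (rule suminf_mult2[symmetric]) (rule summable_geometric, simp)
    also have "\<dots> = 2 * (1/2) ^ m"
      by (subst suminf_geometric) simp_all
    finally show ?thesis .
  qed
  define Z where "Z n = Y n + (\<Sum>k. D k n)" for n
  have T: "(\<lambda>n. \<Sum>k. D k n) \<in> l_infty"
    using tail[of 0] by (intro l_inftyI[of _ 2]) simp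
  have Zl: "Z \<in> l_infty" unfolding Z_def by (intro l_infty_add Y T)
  have "norm (x (r m) - Ainf Z) \<le> 2 * (1/2) ^ m" for m
  proof -
    have "norm ((Y n + (\<Sum>k<m. D k n)) - Z n) \<le> 2 * (1/2) ^ m" for n
    proof -
      have "(\<Sum>k. D k n) = (\<Sum>k. D (k + m) n) + (\<Sum>k<m. D k n)"
        using smb[of 0 n] by (intro suminf_split_initial_segment) simp
      then have "(Y n + (\<Sum>k<m. D k n)) - Z n = - (\<Sum>k. D (k + m) n)" by (simp add: Z_def)
      then show ?thesis using tail[of m n] by simp
    qed
    then show ?thesis
      unfolding rep using Y S Zl by (simp add: Ainf_diff l_infty_add norm_Ainf_le)
  qed
  moreover have "(\<lambda>m. 2 * (1/2 :: real) ^ m) \<longlonglongrightarrow> 0"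
    by (intro tendsto_mult_right_zero LIMSEQ_power_zero) simp
  ultimately have "(\<lambda>m. x (r m) - Ainf Z) \<longlonglongrightarrow> 0"
    by (rule Lim_null_comparison[OF always_eventually[OF allI]])
  then have "(x \<circ> r) \<longlonglongrightarrow> Ainf Z" by (simp add: LIM_zero_iff o_def)
  then show "convergent x"
    using Cauchy_converges_subseq[OF C r_mono] by (auto simp: convergent_def)
qed

instantiation ainf :: (cstar_algebra) cstar_algebra
begin

lift_definition scaleC_ainf :: "complex \<Rightarrow> 'a ainf \<Rightarrow> 'a ainf" is "\<lambda>c X n. c *\<^sub>C X n"
proof -
  fix c and X Y :: "nat \<Rightarrow> 'a" assume a: "ainf_rel X Y"
  have "c *\<^sub>C (X n - Y n) = c *\<^sub>C X n - c *\<^sub>C Y n" for n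
    using scaleC_add_right[of c "X n - Y n" "Y n"] by (simp add: algebra_simps)
  then show "ainf_rel (\<lambda>n. c *\<^sub>C X n) (\<lambda>n. c *\<^sub>C Y n)"
    using a c_zero_scaleC[of "\<lambda>n. X n - Y n" c] by (simp add: ainf_rel_def l_infty_scaleC)
qed

lift_definition star_ainf :: "'a ainf \<Rightarrow> 'a ainf" is "\<lambda>X n. (X n)\<^sup>\<star>"
  unfolding ainf_rel_def by (auto intro!: l_infty_star dest: c_zero_star simp: star_diff)

lemma Ainf_scaleC: "X \<in> l_infty \<Longrightarrow> c *\<^sub>C Ainf X = Ainf (\<lambda>n. c *\<^sub>C X n)"
  by (rule scaleC_ainf.abs_eq) (auto simp: eq_onp_def ainf_rel_def c_zero_iff)

lemma Ainf_star: "X \<in> l_infty \<Longrightarrow> (Ainf X)\<^sup>\<star> = Ainf (\<lambda>n. (X n)\<^sup>\<star>)"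
  by (rule star_ainf.abs_eq) (auto simp: eq_onp_def ainf_rel_def c_zero_iff)

instance
proof
  fix x y :: "'a ainf" and r :: real and c d :: complex
  obtain X where X: "X \<in> l_infty" "x = Ainf X" by (rule Ainf_cases)
  obtain Y where Y: "Y \<in> l_infty" "y = Ainf Y" by (rule Ainf_cases)
  note [simp] = X Y Ainf_ops Ainf_scaleC Ainf_star l_infty_intros
  show "c *\<^sub>C (x + y) = c *\<^sub>C x + c *\<^sub>C y" by (simp add: scaleC_add_right)
  show "(c + d) *\<^sub>C x = c *\<^sub>C x + d *\<^sub>C x" by (simp add: scaleC_add_left)
  show "c *\<^sub>C d *\<^sub>C x = (c * d) *\<^sub>C x" by (simp add: scaleC_scaleC)
  show "r *\<^sub>R x = complex_of_real r *\<^sub>C x" by (simp add: scaleR_scaleC)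
  show "c *\<^sub>C x * y = c *\<^sub>C (x * y)" by (simp add: mult_scaleC_left)
  show "x * c *\<^sub>C y = c *\<^sub>C (x * y)" by (simp add: mult_scaleC_right)
  show "(x\<^sup>\<star>)\<^sup>\<star> = x" by (simp add: star_star)
  show "(x + y)\<^sup>\<star> = x\<^sup>\<star> + y\<^sup>\<star>" by (simp add: star_add)
  show "(c *\<^sub>C x)\<^sup>\<star> = cnj c *\<^sub>C x\<^sup>\<star>" by (simp add: star_scaleC)
  show "(x * y)\<^sup>\<star> = y\<^sup>\<star> * x\<^sup>\<star>" by (simp add: star_mult)
  have norm_cong: "norm (Ainf U) = norm (Ainf V)"
    if "U \<in> l_infty" "V \<in> l_infty" "\<And>n. norm (U n) = norm (V n)" for U V :: "nat \<Rightarrow> 'a"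
    using that norm_Ainf_le_iff[of U "norm (Ainf V)"] norm_Ainf_le_iff[of V "norm (Ainf U)"]
      norm_Ainf_ev[of U] norm_Ainf_ev[of V] by (intro antisym) auto
  show "norm (c *\<^sub>C x) = cmod c * norm x"
    using norm_cong[of "\<lambda>n. c *\<^sub>C X n" "\<lambda>n. cmod c *\<^sub>R X n"] norm_scaleR[of "cmod c" x]
    by (simp add: norm_scaleC)
  show "norm (x\<^sup>\<star> * x) = (norm x)\<^sup>2"
  proof (rule antisym)
    have "norm (x\<^sup>\<star>) = norm x" using norm_cong[of "\<lambda>n. (X n)\<^sup>\<star>" X] by simp
    then show "norm (x\<^sup>\<star> * x) \<le> (norm x)\<^sup>2"
      using norm_mult_ineq[of "x\<^sup>\<star>" x] by (simp only: power2_eq_square)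
    have "norm x \<le> sqrt (norm (x\<^sup>\<star> * x))"
      unfolding X(2)
    proof (subst norm_Ainf_le_iff[OF X(1)], intro allI impI)
      fix e assume e: "sqrt (norm ((Ainf X)\<^sup>\<star> * Ainf X)) < e"
      then have e0: "0 < e" by (rule le_less_trans[rotated]) simp
      have "norm ((Ainf X)\<^sup>\<star> * Ainf X) < e\<^sup>2"
        using e e0 real_less_rsqrt real_sqrt_less_iff[of "norm ((Ainf X)\<^sup>\<star> * Ainf X)" "e\<^sup>2"] by simp
      then have "norm (Ainf (\<lambda>n. (X n)\<^sup>\<star> * X n)) < e\<^sup>2" by simp
      then have "\<forall>\<^sub>F n in sequentially. norm ((X n)\<^sup>\<star> * X n) < e\<^sup>2"
        by (intro norm_Ainf_ev) simp_all
      then show "\<forall>\<^sub>F n in sequentially. norm (X n) < e"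
      proof eventually_elim
        case (elim n)
        then show ?case using e0 by (auto simp: cstar_identity intro: power_less_imp_less_base)
      qed
    qed
    then show "(norm x)\<^sup>2 \<le> norm (x\<^sup>\<star> * x)"
      using power_mono[of "norm x" "sqrt (norm (x\<^sup>\<star> * x))" 2] by (simp del: X(2))
  qed
qed

end

definition const_ainf :: "'a::cstar_algebra \<Rightarrow> 'a ainf" where
  "const_ainf a = Ainf (\<lambda>n. a)"

instantiation ainf :: (unital_cstar_algebra) unital_cstar_algebra
begin

definition one_ainf :: "'a ainf" where "one_ainf = const_ainf 1"

instance
proof
  fix x :: "'a ainf"
  obtain X where X: "X \<in> l_infty" "x = Ainf X" by (rule Ainf_cases)
  show "1 * x = x" "x * 1 = x"
    using X by (simp_all add: one_ainf_def const_ainf_def Ainf_mult)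
  show "(0 :: 'a ainf) \<noteq> 1"
    by (simp add: one_ainf_def const_ainf_def Ainf_zero Ainf_eq_iff c_zero_def LIMSEQ_const_iff)
  show "norm (1 :: 'a ainf) = 1"
  proof (rule antisym)
    show "norm (1 :: 'a ainf) \<le> 1"
      unfolding one_ainf_def const_ainf_def by (rule norm_Ainf_le) simp
    show "1 \<le> norm (1 :: 'a ainf)"
    proof (rule ccontr)
      assume "\<not> 1 \<le> norm (1 :: 'a ainf)"
      then have "\<forall>\<^sub>F n in sequentially. norm (1 :: 'a) < 1"
        unfolding one_ainf_def const_ainf_def by (intro norm_Ainf_ev) simp_all
      then show False by simp
    qed
  qed
qed

end

section \<open>Elements and properties of C*-algebras\<close>

definition invertible_elt :: "'a::unital_cstar_algebra \<Rightarrow> bool" where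
  "invertible_elt x \<longleftrightarrow> (\<exists>y. x * y = 1 \<and> y * x = 1)"

definition spectrum :: "'a::unital_cstar_algebra \<Rightarrow> complex set" where
  "spectrum x = {c. \<not> invertible_elt (c *\<^sub>C 1 - x)}"

definition positive_elts :: "'a::unital_cstar_algebra set" where
  "positive_elts = {x. x\<^sup>\<star> = x \<and> spectrum x \<subseteq> complex_of_real ` {0..}}"

definition is_projection :: "'a::cstar_algebra \<Rightarrow> bool" where
  "is_projection p \<longleftrightarrow> p\<^sup>\<star> = p \<and> p * p = p"

definition mvn_equiv :: "'a::cstar_algebra \<Rightarrow> 'a \<Rightarrow> bool" where
  "mvn_equiv p q \<longleftrightarrow> (\<exists>v. v\<^sup>\<star> * v = p \<and> v * v\<^sup>\<star> = q)"

definition hereditary_subalgebra :: "'a::cstar_algebra \<Rightarrow> 'a set" where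
  "hereditary_subalgebra z = closure {z * y * z |y. True}"

definition two_sided_ideal :: "'a::cstar_algebra set \<Rightarrow> bool" where
  "two_sided_ideal I \<longleftrightarrow> 0 \<in> I \<and> (\<forall>x\<in>I. \<forall>y\<in>I. x + y \<in> I) \<and> (\<forall>c. \<forall>x\<in>I. c *\<^sub>C x \<in> I) \<and>
     (\<forall>a. \<forall>x\<in>I. a * x \<in> I \<and> x * a \<in> I)"

definition simple_cstar :: "'a::cstar_algebra itself \<Rightarrow> bool" where
  "simple_cstar (_ :: 'a itself) \<longleftrightarrow>
     (UNIV :: 'a set) \<noteq> {0} \<and> (\<forall>I :: 'a set. two_sided_ideal I \<and> closed I \<longrightarrow> I = {0} \<or> I = UNIV)"

definition separable_cstar :: "'a::cstar_algebra itself \<Rightarrow> bool" where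
  "separable_cstar (_ :: 'a itself) \<longleftrightarrow> separable_space (euclidean :: 'a topology)"

definition finite_cstar :: "'a::unital_cstar_algebra itself \<Rightarrow> bool" where
  "finite_cstar (_ :: 'a itself) \<longleftrightarrow> (\<forall>v :: 'a. v\<^sup>\<star> * v = 1 \<longrightarrow> v * v\<^sup>\<star> = 1)"

definition stable_rank_one :: "'a::unital_cstar_algebra itself \<Rightarrow> bool" where
  "stable_rank_one (_ :: 'a itself) \<longleftrightarrow> closure {x :: 'a. invertible_elt x} = UNIV"

definition star_hom :: "('a::cstar_algebra \<Rightarrow> 'b::cstar_algebra) \<Rightarrow> bool" where
  "star_hom f \<longleftrightarrow> (\<forall>x y. f (x + y) = f x + f y) \<and> (\<forall>c x. f (c *\<^sub>C x) = c *\<^sub>C f x) \<and>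
     (\<forall>x y. f (x * y) = f x * f y) \<and> (\<forall>x. f (x\<^sup>\<star>) = (f x)\<^sup>\<star>)"

section \<open>Tracially sequentially-split homomorphisms\<close>

definition central_seq_algebra :: "'a::cstar_algebra ainf set" where
  "central_seq_algebra = {x. \<forall>a. x * const_ainf a = const_ainf a * x}"

text \<open>The condition on subsequences does not depend on the representing sequence.\<close>

definition ainf_pospos :: "'a::unital_cstar_algebra ainf set" where
  "ainf_pospos = {x \<in> positive_elts. \<exists>X\<in>l_infty. x = Ainf X \<and>
     \<not> (\<exists>k :: nat \<Rightarrow> nat. strict_mono k \<and> (\<lambda>n. X (k n)) \<longlonglongrightarrow> 0)}"

lemma ainf_pospos_rep_indep:
  assumes "X \<in> l_infty" "Y \<in> l_infty" "Ainf X = Ainf Y" "strict_mono k" "(\<lambda>n. X (k n)) \<longlonglongrightarrow> 0"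
  shows "(\<lambda>n. Y (k n)) \<longlonglongrightarrow> 0"
proof -
  have "(\<lambda>n. X n - Y n) \<longlonglongrightarrow> 0" using assms by (simp add: Ainf_eq_iff c_zero_iff)
  from LIMSEQ_subseq_LIMSEQ[OF this assms(4)]
  have "(\<lambda>n. X (k n) - Y (k n)) \<longlonglongrightarrow> 0" by (simp add: o_def)
  from tendsto_diff[OF assms(5) this] show ?thesis by simp
qed

definition tracially_sequentially_split ::
    "('a::unital_cstar_algebra \<Rightarrow> 'b::cstar_algebra) \<Rightarrow> bool" where
  "tracially_sequentially_split \<phi> \<longleftrightarrow>
     star_hom \<phi> \<and>
     (\<forall>z :: 'a ainf. z \<in> ainf_pospos \<and> z \<noteq> 0 \<longrightarrow>
       (\<exists>(\<psi> :: 'b \<Rightarrow> 'a ainf) g.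
          star_hom \<psi> \<and> is_projection g \<and> g \<noteq> 0 \<and> g \<in> central_seq_algebra \<and>
          (\<forall>a. \<psi> (\<phi> a) = const_ainf a * g) \<and>
          (\<exists>p. is_projection p \<and> p \<in> hereditary_subalgebra z \<and> mvn_equiv (1 - g) p)))"

end

theory Submission
  imports Defs
begin

text \<open>Finiteness: \<open>{x \<in> A. x g = 0}\<close> is a proper closed ideal of the simple algebra \<open>A\<close>, so
  \<open>a \<mapsto> a g = \<psi> (\<phi> a)\<close> is injective, and an isometry of \<open>A\<close> is a unitary because its image
  in \<open>B\<close> is one.

  Stable rank one: \<open>B\<close>, and hence \<open>A\<close>, is finite, so a noninvertible element of \<open>A\<close> is close to
  some \<open>x\<close> annihilated by nonzero positive elements from the left and from the right; by
  simplicity these can be merged, after multiplying \<open>x\<close> by invertible elements, into a single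
  two-sided annihilator \<open>c \<ge> 0\<close>. Apply the hypothesis to \<open>z = c\<close>. In the corner of \<open>g\<close> the
  element \<open>x g = \<psi> (\<phi> x)\<close> is close to invertible elements, since \<open>B\<close> has stable rank one. In the
  corner of \<open>1 - g\<close> the element \<open>x (1 - g)\<close> is orthogonal to a copy \<open>p\<close> of \<open>1 - g\<close>, and a
  matrix \<open>(x, 0; 0, 0)\<close> is the limit of the invertible matrices \<open>(x, \<epsilon>; - \<epsilon>, \<delta>)\<close> with
  \<open>\<delta>\<close> much smaller than \<open>\<epsilon>\<^sup>2\<close>. Invertible elements of the sequence algebra lift to
  sequences of eventually invertible elements.

  The functional calculus needed is reduced to square roots of positive elements, given by the
  binomial series, and to positive and negative parts.\<close>

section \<open>Square roots in C*-algebras\<close>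

lemma star_one [simp]: "(1::'a::unital_cstar_algebra)\<^sup>\<star> = 1"
  using star_mult[of "1\<^sup>\<star>" "1::'a"] by (simp add: star_star)

lemma star_scaleR: "(r *\<^sub>R (x::'a::cstar_algebra))\<^sup>\<star> = r *\<^sub>R x\<^sup>\<star>"
  by (simp add: scaleR_scaleC star_scaleC)

lemma star_minus: "(- (x::'a::cstar_algebra))\<^sup>\<star> = - x\<^sup>\<star>"
  using star_diff[of 0 x] by simp

lemmas star_simps = star_star star_add star_diff star_minus star_scaleR star_mult

lemma scaleC_minus_right: "c *\<^sub>C (- (x::'a::cstar_algebra)) = - (c *\<^sub>C x)"
  using scaleC_scaleC[of c "-1" x] scaleC_scaleC[of "-1" c x] scaleR_scaleC[of "-1" x]
    scaleR_scaleC[of "-1" "c *\<^sub>C x"] by simp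

lemma scaleC_minus_left: "(- c) *\<^sub>C (x::'a::cstar_algebra) = - (c *\<^sub>C x)"
  using scaleC_scaleC[of "-1" c x] scaleR_scaleC[of "-1" "c *\<^sub>C x"] by simp

lemma scaleC_ii: "\<i> *\<^sub>C (\<i> *\<^sub>C (x::'a::cstar_algebra)) = - x"
  using scaleR_scaleC[of "-1" x] by (simp add: scaleC_scaleC)

lemma scaleC_scaleR: "c *\<^sub>C (r *\<^sub>R (x::'a::cstar_algebra)) = r *\<^sub>R (c *\<^sub>C x)"
  by (simp add: scaleR_scaleC scaleC_scaleC mult.commute)

lemma scaleC_diff_right: "c *\<^sub>C ((x::'a::cstar_algebra) - y) = c *\<^sub>C x - c *\<^sub>C y"
  using scaleC_add_right[of c x "- y"] by (simp add: scaleC_minus_right)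

lemma star_power: "((x::'a::unital_cstar_algebra) ^ n)\<^sup>\<star> = (x\<^sup>\<star>) ^ n"
  by (induction n) (simp_all add: star_mult power_commutes)

lemma bounded_linear_star: "bounded_linear (star :: 'a::cstar_algebra \<Rightarrow> 'a)"
  by (rule bounded_linear_intro[of _ 1]) (simp_all add: star_add star_scaleR)

text \<open>Coefficients of the binomial series for the square root of \<open>1 - x\<close>.\<close>

definition sqrt_coeff :: "nat \<Rightarrow> real" where
  "sqrt_coeff n = (-1) ^ n * ((1/2) gchoose n)"

lemma sqrt_coeff_0 [simp]: "sqrt_coeff 0 = 1"
  by (simp add: sqrt_coeff_def)

text \<open>From the first coefficient -1/2 on, consecutive ones have the positive ratio (n + 1/2) /
  (n + 2).\<close>

lemma sqrt_coeff_Suc_nonpos: "sqrt_coeff (Suc n) \<le> 0"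
proof (induction n)
  case (Suc n)
  have "(2 + real n) * sqrt_coeff (Suc (Suc n)) = (1/2 + real n) * sqrt_coeff (Suc n)"
  proof -
    have "(2 + real n) * ((1/2::real) gchoose Suc (Suc n)) = - ((1/2 + real n) * ((1/2) gchoose Suc n))"
      using gbinomial_mult_1[of "1/2 :: real" "Suc n"] by (simp add: algebra_simps)
    then have "(-1) ^ n * ((2 + real n) * ((1/2::real) gchoose Suc (Suc n)))
        = (-1) ^ n * - ((1/2 + real n) * ((1/2) gchoose Suc n))" by simp
    then show ?thesis by (simp add: sqrt_coeff_def algebra_simps)
  qed
  moreover have "(1/2 + real n) * sqrt_coeff (Suc n) \<le> 0"
    using Suc by (simp add: mult_nonneg_nonpos)
  ultimately have "(2 + real n) * sqrt_coeff (Suc (Suc n)) \<le> 0" by simp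
  then show ?case unfolding mult_le_0_iff by linarith
qed (simp add: sqrt_coeff_def)

text \<open>The partial sums are the coefficients of the series for the inverse square root of
  \<open>1 - x\<close>, nonnegative by a ratio recursion.\<close>

lemma sum_sqrt_coeff_nonneg: "0 \<le> (\<Sum>k\<le>n. sqrt_coeff k)"
proof -
  have "0 \<le> (-1) ^ n * (((-1/2)::real) gchoose n)" for n
  proof (induction n)
    case (Suc n)
    have "(1 + real n) * ((-1) ^ Suc n * (((-1/2)::real) gchoose Suc n))
        = (1/2 + real n) * ((-1) ^ n * ((-1/2) gchoose n))"
    proof -
      have "(1 + real n) * ((-1/2::real) gchoose Suc n) = - ((1/2 + real n) * ((-1/2) gchoose n))"
        using gbinomial_mult_1[of "-1/2 :: real" "n"] by (simp add: algebra_simps)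
      then have "(-1) ^ n * ((1 + real n) * ((-1/2::real) gchoose Suc n))
          = (-1) ^ n * - ((1/2 + real n) * ((-1/2) gchoose n))" by simp
      then show ?thesis by (simp add: algebra_simps)
    qed
    moreover have "0 \<le> (1/2 + real n) * ((-1) ^ n * ((-1/2) gchoose n))" using Suc by simp
    ultimately have "0 \<le> (1 + real n) * ((-1) ^ Suc n * (((-1/2)::real) gchoose Suc n))" by simp
    then show ?case unfolding zero_le_mult_iff[of "1 + real n"] by linarith
  qed simp
  then show ?thesis
    using gbinomial_sum_lower_neg[of "1/2 :: real" n] by (simp add: sqrt_coeff_def mult.commute)
qed

text \<open>All coefficients but the zeroth are nonpositive, so this sum is 1 minus a partial sum.
  The bound yields convergence on the whole closed unit ball.\<close>

lemma sum_abs_sqrt_coeff_Suc: "(\<Sum>k<n. \<bar>sqrt_coeff (Suc k)\<bar>) \<le> 1"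
proof -
  have "(\<Sum>k<n. \<bar>sqrt_coeff (Suc k)\<bar>) = 1 - (\<Sum>k\<le>n. sqrt_coeff k)"
    using sqrt_coeff_Suc_nonpos
    by (simp add: sum.atMost_shift sum_negf)
  then show ?thesis using sum_sqrt_coeff_nonneg[of n] by simp
qed

lemma summable_abs_sqrt_coeff_Suc: "summable (\<lambda>n. \<bar>sqrt_coeff (Suc n)\<bar>)"
  by (rule summableI_nonneg_bounded[OF _ sum_abs_sqrt_coeff_Suc]) simp

lemma summable_abs_sqrt_coeff: "summable (\<lambda>n. \<bar>sqrt_coeff n\<bar>)"
  using summable_abs_sqrt_coeff_Suc by (rule iffD1[OF summable_Suc_iff])

text \<open>The series converges absolutely even for \<open>norm x = 1\<close>. The bound on
  \<open>1 - s\<close> later certifies that \<open>s\<close> is positive, and the commutation clause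
  stands in for functional calculus.\<close>

lemma sqrt_one_minus:
  fixes x :: "'a::unital_cstar_algebra"
  assumes x: "x\<^sup>\<star> = x" "norm x \<le> 1"
  obtains s where "s\<^sup>\<star> = s" "s * s = 1 - x" "norm (1 - s) \<le> 1"
    "\<And>y. y * x = x * y \<Longrightarrow> y * s = s * y"
proof
  define t where "t = (\<lambda>n. sqrt_coeff n *\<^sub>R x ^ n)"
  define s where "s = (\<Sum>n. t n)"
  have px: "norm (x ^ n) \<le> 1" for n
    using norm_power_ineq[of x n] power_le_one[of "norm x" n] x by simp
  have tb: "norm (t n) \<le> \<bar>sqrt_coeff n\<bar>" for n
    using mult_left_mono[OF px, of "\<bar>sqrt_coeff n\<bar>" n] by (simp add: t_def)
  have smn: "summable (\<lambda>n. norm (t n))"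
    using tb by (intro summable_comparison_test'[OF summable_abs_sqrt_coeff, of 0]) simp
  then have sm: "summable t" by (rule summable_norm_cancel)
  show "s\<^sup>\<star> = s"
    unfolding s_def bounded_linear.suminf[OF bounded_linear_star sm]
    using x by (simp add: t_def star_scaleR star_power)
  show "norm (1 - s) \<le> 1"
  proof -
    have "s = (\<Sum>n. t (Suc n)) + 1"
      using suminf_split_head[OF sm] by (simp add: s_def t_def)
    then have "norm (1 - s) = norm (\<Sum>n. t (Suc n))" by (simp add: norm_minus_commute)
    also have "\<dots> \<le> (\<Sum>n. \<bar>sqrt_coeff (Suc n)\<bar>)"
      using tb by (intro norm_suminf_le summable_abs_sqrt_coeff_Suc) auto
    also have "\<dots> \<le> 1"
      by (rule suminf_le_const[OF summable_abs_sqrt_coeff_Suc sum_abs_sqrt_coeff_Suc])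
    finally show ?thesis .
  qed
  show "y * s = s * y" if "y * x = x * y" for y
  proof -
    have "y * x ^ n = x ^ n * y" for n
      by (induction n) (simp_all, metis that mult.assoc)
    then show ?thesis
      unfolding s_def suminf_mult[OF sm, symmetric] suminf_mult2[OF sm]
      by (simp add: t_def)
  qed
  show "s * s = 1 - x"
  proof -
    \<comment> \<open>By Vandermonde, convolving the coefficients for exponent 1/2 gives those for
      exponent 1, which vanish from degree 2 on.\<close>
    have c: "(\<Sum>i\<le>k. t i * t (k - i)) = ((-1) ^ k * (1 gchoose k)) *\<^sub>R x ^ k" for k
    proof -
      have "(\<Sum>i\<le>k. t i * t (k - i))
          = (\<Sum>i\<le>k. ((-1) ^ k * (((1/2) gchoose i) * ((1/2) gchoose (k - i)))) *\<^sub>R x ^ k)"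
      proof (rule sum.cong)
        fix i assume "i \<in> {..k}"
        then have p: "(-1) ^ i * (-1) ^ (k - i) = ((-1) ^ k :: real)" "x ^ i * x ^ (k - i) = x ^ k"
          by (simp_all flip: power_add)
        have "t i * t (k - i) = (((-1) ^ i * (-1) ^ (k - i)) * (((1/2) gchoose i) * ((1/2) gchoose (k - i))))
            *\<^sub>R (x ^ i * x ^ (k - i))"
          by (simp add: t_def sqrt_coeff_def mult_ac)
        then show "t i * t (k - i) = ((-1) ^ k * (((1/2) gchoose i) * ((1/2) gchoose (k - i)))) *\<^sub>R x ^ k"
          unfolding p .
      qed simp
      also have "\<dots> = ((-1) ^ k * (\<Sum>i\<le>k. ((1/2) gchoose i) * ((1/2) gchoose (k - i)))) *\<^sub>R x ^ k"
        by (simp add: scaleR_sum_left sum_distrib_left)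
      finally show ?thesis
        using gbinomial_Vandermonde[of "1/2 :: real" "1/2" k] by (simp add: atLeast0AtMost)
    qed
    have "s * s = (\<Sum>k. ((-1) ^ k * (1 gchoose k)) *\<^sub>R x ^ k)"
      unfolding s_def by (simp add: Cauchy_product[OF smn smn] c)
    also have "\<dots> = (\<Sum>k\<in>{0,1}. ((-1) ^ k * (1 gchoose k)) *\<^sub>R x ^ k)"
    proof (rule suminf_finite)
      fix n :: nat assume "n \<notin> {0,1}"
      then have "(1::nat) choose n = 0" by (intro binomial_eq_0) auto
      then have "(1::real) gchoose n = 0"
        by (metis binomial_gbinomial of_nat_0 of_nat_1)
      then show "((-1) ^ n * (1 gchoose n)) *\<^sub>R x ^ n = 0" by simp
    qed simp
    finally show ?thesis by simp
  qed
qed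

section \<open>Positive elements\<close>

text \<open>Positivity expressed through the norm; this makes the positive elements visibly a convex
  cone, and by \<open>sqrt_one_minus\<close> they are the squares of self-adjoint elements.\<close>

definition cpos :: "'a::unital_cstar_algebra \<Rightarrow> bool" where
  "cpos a \<longleftrightarrow> a\<^sup>\<star> = a \<and> (\<exists>t\<ge>0. norm (t *\<^sub>R 1 - a) \<le> t)"

lemma cpos_star: "cpos a \<Longrightarrow> a\<^sup>\<star> = a"
  by (simp add: cpos_def)

lemma cposI: "a\<^sup>\<star> = a \<Longrightarrow> norm (t *\<^sub>R 1 - a) \<le> t \<Longrightarrow> cpos a"
  by (auto simp: cpos_def intro!: exI[of _ t] order_trans[OF norm_ge_zero])

lemma cpos_scaleR: assumes "cpos a" "0 \<le> r" shows "cpos (r *\<^sub>R a)"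
proof -
  obtain t where t: "norm (t *\<^sub>R 1 - a) \<le> t" using assms by (auto simp: cpos_def)
  have "(r * t) *\<^sub>R 1 - r *\<^sub>R a = r *\<^sub>R (t *\<^sub>R 1 - a)" by (simp add: scaleR_diff_right)
  then have "norm ((r * t) *\<^sub>R 1 - r *\<^sub>R a) \<le> r * t"
    using mult_left_mono[OF t assms(2)] assms by simp
  then show ?thesis using assms by (intro cposI[of _ "r * t"]) (auto simp: cpos_def star_scaleR)
qed

lemma cpos_add: assumes "cpos a" "cpos b" shows "cpos (a + b)"
proof -
  obtain t u where "norm (t *\<^sub>R 1 - a) \<le> t" "norm (u *\<^sub>R 1 - b) \<le> u"
    using assms by (auto simp: cpos_def)
  then have "norm ((t *\<^sub>R 1 - a) + (u *\<^sub>R 1 - b)) \<le> t + u" by (rule norm_triangle_mono)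
  moreover have "(t *\<^sub>R 1 - a) + (u *\<^sub>R 1 - b) = (t + u) *\<^sub>R 1 - (a + b)"
    by (simp add: algebra_simps)
  ultimately show ?thesis using assms by (intro cposI[of _ "t + u"]) (auto simp: cpos_def star_add)
qed

lemma cpos_one_minus: "x\<^sup>\<star> = x \<Longrightarrow> norm x \<le> t \<Longrightarrow> cpos (t *\<^sub>R 1 - x)"
  by (rule cposI[of _ t]) (simp_all add: star_simps)

lemma cpos_scalar: "0 \<le> t \<Longrightarrow> cpos (t *\<^sub>R 1)"
  using cpos_one_minus[of 0 t] by simp

lemma cpos_0 [simp]: "cpos 0" using cpos_scalar[of 0] by simp

lemma cpos_1 [simp]: "cpos 1" using cpos_scalar[of 1] by simp

text \<open>Division by a suitable \<open>t\<close> turns \<open>a\<close> into \<open>1 - x\<close>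
  with \<open>norm x \<le> 1\<close>; this needs \<open>t > 0\<close>, hence the separate case
  \<open>a = 0\<close>.\<close>

lemma cpos_sqrt:
  assumes "cpos a"
  obtains s where "s\<^sup>\<star> = s" "cpos s" "s * s = a" "\<And>y. y * a = a * y \<Longrightarrow> y * s = s * y"
proof (cases "a = 0")
  case False
  obtain t where t: "t \<ge> 0" "norm (t *\<^sub>R 1 - a) \<le> t" using assms by (auto simp: cpos_def)
  with False have t0: "t > 0" by (cases "t = 0") auto
  define x where "x = 1 - a /\<^sub>R t"
  have "x = (t *\<^sub>R 1 - a) /\<^sub>R t" using t0 by (simp add: x_def scaleR_diff_right)
  then have nx: "norm x \<le> 1" using t t0 by (simp add: divide_le_eq flip: divide_inverse_commute)
  have sx: "x\<^sup>\<star> = x" using assms by (simp add: x_def star_simps cpos_star)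
  obtain s where s: "s\<^sup>\<star> = s" "s * s = 1 - x" "norm (1 - s) \<le> 1"
    "\<And>y. y * x = x * y \<Longrightarrow> y * s = s * y"
    using sqrt_one_minus[OF sx nx] by metis
  show ?thesis
  proof
    have "cpos s" using s(1,3) by (intro cposI[of _ 1]) simp_all
    then show "cpos (sqrt t *\<^sub>R s)" using t0 by (intro cpos_scaleR) simp_all
    then show "(sqrt t *\<^sub>R s)\<^sup>\<star> = sqrt t *\<^sub>R s" by (rule cpos_star)
    show "(sqrt t *\<^sub>R s) * (sqrt t *\<^sub>R s) = a"
    proof -
      have "(sqrt t *\<^sub>R s) * (sqrt t *\<^sub>R s) = (sqrt t * sqrt t) *\<^sub>R (s * s)"
        by (simp only: mult_scaleR_left mult_scaleR_right scaleR_scaleR)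
      also have "\<dots> = t *\<^sub>R (1 - x)" using t0 s(2) by simp
      also have "\<dots> = a" using t0 by (simp add: x_def)
      finally show ?thesis .
    qed
    show "y * (sqrt t *\<^sub>R s) = (sqrt t *\<^sub>R s) * y" if "y * a = a * y" for y
      using s(4)[of y] that by (simp add: x_def algebra_simps)
  qed
next
  case True
  show ?thesis by (rule that[of 0]) (auto simp: True)
qed

section \<open>Norm estimates for commuting self-adjoint elements\<close>

lemma star_mult_self_complex:
  fixes u v :: "'a::cstar_algebra"
  assumes "u\<^sup>\<star> = u" "v\<^sup>\<star> = v" "u * v = v * u"
  shows "(u + \<i> *\<^sub>C v)\<^sup>\<star> * (u + \<i> *\<^sub>C v) = u * u + v * v"
    "(u + \<i> *\<^sub>C v) * (u + \<i> *\<^sub>C v) = (u * u - v * v) + \<i> *\<^sub>C (2 *\<^sub>R (u * v))"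
proof -
  have "\<i> *\<^sub>C (v * u - \<i> *\<^sub>C (v * v)) = \<i> *\<^sub>C (v * u) + v * v"
    using scaleC_add_right[of \<i> "v * u" "- (\<i> *\<^sub>C (v * v))"] by (simp add: scaleC_minus_right scaleC_ii)
  then show "(u + \<i> *\<^sub>C v)\<^sup>\<star> * (u + \<i> *\<^sub>C v) = u * u + v * v"
    using assms by (simp add: star_add star_scaleC scaleC_minus_left mult_scaleC_left
        mult_scaleC_right scaleC_ii algebra_simps)
  show "(u + \<i> *\<^sub>C v) * (u + \<i> *\<^sub>C v) = (u * u - v * v) + \<i> *\<^sub>C (2 *\<^sub>R (u * v))"
    using assms by (simp add: mult_scaleC_left mult_scaleC_right scaleC_ii scaleR_2 scaleC_add_right algebra_simps)
qed

lemma norm_real_part_le: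
  fixes u v :: "'a::cstar_algebra"
  assumes "u\<^sup>\<star> = u" "v\<^sup>\<star> = v"
  shows "norm u \<le> norm (u + \<i> *\<^sub>C v)"
proof -
  have "2 *\<^sub>R u = (u + \<i> *\<^sub>C v) + (u + \<i> *\<^sub>C v)\<^sup>\<star>"
    using assms by (simp add: star_add star_scaleC scaleC_minus_left scaleR_2)
  then have "norm (2 *\<^sub>R u) \<le> norm (u + \<i> *\<^sub>C v) + norm ((u + \<i> *\<^sub>C v)\<^sup>\<star>)"
    by (metis norm_triangle_ineq)
  then show ?thesis by simp
qed

text \<open>For U = u + i v the C*-identity makes \<open>norm (u * u + v * v)\<close> the square of
  the norm of U, while \<open>u\<close> and \<open>u * u - v * v\<close> are the real parts of U and
  its square.\<close>

lemma norm_sq_le_of_commuting_squares: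
  fixes u v :: "'a::cstar_algebra"
  assumes "u\<^sup>\<star> = u" "v\<^sup>\<star> = v" "u * v = v * u"
  shows "(norm u)\<^sup>2 \<le> norm (u * u + v * v)"
    and "norm (u * u - v * v) \<le> norm (u * u + v * v)"
proof -
  let ?U = "u + \<i> *\<^sub>C v"
  have U: "(norm ?U)\<^sup>2 = norm (u * u + v * v)"
    using cstar_identity[of ?U] star_mult_self_complex(1)[OF assms] by simp
  show "(norm u)\<^sup>2 \<le> norm (u * u + v * v)"
    using power_mono[OF norm_real_part_le[OF assms(1,2)], of 2] U by simp
  have "norm (u * u - v * v) \<le> norm (?U * ?U)"
    unfolding star_mult_self_complex(2)[OF assms]
    by (rule norm_real_part_le) (use assms in \<open>simp_all add: star_simps\<close>)
  also have "\<dots> \<le> norm ?U * norm ?U" by (rule norm_mult_ineq)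
  finally show "norm (u * u - v * v) \<le> norm (u * u + v * v)" using U by (simp add: power2_eq_square)
qed

lemma norm_self_adjoint_square:
  "(h::'a::cstar_algebra)\<^sup>\<star> = h \<Longrightarrow> norm (h * h) = (norm h)\<^sup>2"
  using cstar_identity[of h] by simp

lemma self_adjoint_square_eq_0: "(h::'a::cstar_algebra)\<^sup>\<star> = h \<Longrightarrow> h * h = 0 \<Longrightarrow> h = 0"
  using norm_self_adjoint_square[of h] by simp

text \<open>With \<open>k\<close> the root of \<open>(norm h)\<^sup>2 - h * h\<close>, the element
  \<open>(norm h)\<^sup>2 - 2 * h * h\<close> is \<open>k * k - h * h\<close>, whose norm is at most
  that of \<open>k * k + h * h\<close>, a scalar.\<close>

lemma cpos_square:
  assumes h: "(h::'a::unital_cstar_algebra)\<^sup>\<star> = h"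
  shows "cpos (h * h)"
proof -
  have n: "norm (h * h) \<le> (norm h)\<^sup>2" using h by (simp add: norm_self_adjoint_square)
  have "cpos ((norm h)\<^sup>2 *\<^sub>R 1 - h * h)"
    by (rule cpos_one_minus) (use h n in \<open>simp_all add: star_simps\<close>)
  then obtain k where k: "k\<^sup>\<star> = k" "k * k = (norm h)\<^sup>2 *\<^sub>R 1 - h * h"
    "\<And>y. y * ((norm h)\<^sup>2 *\<^sub>R 1 - h * h) = ((norm h)\<^sup>2 *\<^sub>R 1 - h * h) * y \<Longrightarrow> y * k = k * y"
    by (rule cpos_sqrt) metis
  have hk: "h * k = k * h" by (rule k(3)) (simp add: algebra_simps)
  have "(norm h)\<^sup>2 *\<^sub>R 1 - 2 *\<^sub>R (h * h) = k * k - h * h" by (simp add: k scaleR_2)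
  then have "norm ((norm h)\<^sup>2 *\<^sub>R 1 - 2 *\<^sub>R (h * h)) \<le> norm (k * k + h * h)"
    using norm_sq_le_of_commuting_squares(2)[OF k(1) h] hk by simp
  also have "\<dots> = (norm h)\<^sup>2" by (simp add: k)
  finally have "cpos (2 *\<^sub>R (h * h))"
    by (intro cposI[of _ "(norm h)\<^sup>2"]) (simp_all add: star_simps h)
  then show ?thesis using cpos_scaleR[of "2 *\<^sub>R (h * h)" "1/2"] by simp
qed

text \<open>Commuting roots \<open>u\<close> of \<open>a\<close> and \<open>v\<close> of
  \<open>norm b - a\<close> have squares adding up to the scalar \<open>norm b\<close>, which
  dominates \<open>(norm u)\<^sup>2 = norm a\<close>.\<close>

lemma cpos_norm_le:
  assumes "cpos a" "cpos (b - a)"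
  shows "norm a \<le> norm b"
proof -
  have "cpos b" using cpos_add[OF assms] by simp
  then have "cpos (norm b *\<^sub>R 1 - b)" by (intro cpos_one_minus cpos_star) simp_all
  from cpos_add[OF this assms(2)] have "cpos (norm b *\<^sub>R 1 - a)" by simp
  then obtain v where v: "v\<^sup>\<star> = v" "v * v = norm b *\<^sub>R 1 - a"
    "\<And>y. y * (norm b *\<^sub>R 1 - a) = (norm b *\<^sub>R 1 - a) * y \<Longrightarrow> y * v = v * y"
    by (rule cpos_sqrt) metis
  obtain u where u: "u\<^sup>\<star> = u" "u * u = a" "\<And>y. y * a = a * y \<Longrightarrow> y * u = u * y"
    using assms(1) by (rule cpos_sqrt) metis
  have "a * v = v * a" by (rule v(3)) (simp add: algebra_simps)
  then have "v * u = u * v" by (intro u(3)) simp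
  then have "(norm u)\<^sup>2 \<le> norm (u * u + v * v)"
    using norm_sq_le_of_commuting_squares(1)[OF u(1) v(1)] by simp
  then show ?thesis using u(1,2) norm_self_adjoint_square[of u] by (simp add: v(2))
qed

lemma cpos_antisym: "cpos a \<Longrightarrow> cpos (- a) \<Longrightarrow> a = 0"
  using cpos_norm_le[of a 0] by simp

lemma cpos_mult_commute:
  assumes "cpos a" "cpos b" "a * b = b * a"
  shows "cpos (a * b)"
proof -
  obtain u where u: "u\<^sup>\<star> = u" "u * u = a" "\<And>y. y * a = a * y \<Longrightarrow> y * u = u * y"
    using assms(1) by (rule cpos_sqrt) metis
  obtain v where v: "v\<^sup>\<star> = v" "v * v = b" "\<And>y. y * b = b * y \<Longrightarrow> y * v = v * y"
    using assms(2) by (rule cpos_sqrt) metis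
  have "b * u = u * b" using assms by (intro u(3)) simp
  then have uv: "u * v = v * u" by (intro v(3)) simp
  have "a * b = (u * v) * (u * v)" using u(2) v(2) uv by (metis mult.assoc)
  moreover have "(u * v)\<^sup>\<star> = u * v" using u(1) v(1) uv by (simp add: star_mult)
  ultimately show ?thesis using cpos_square[of "u * v"] by simp
qed

text \<open>The commuting case comes first: the general \<open>cpos_conj\<close> rests on
  \<open>cpos_star_mult\<close>, whose proof uses this one.\<close>

lemma cpos_conj_self_adjoint:
  assumes "cpos a" "s\<^sup>\<star> = s" "a * s = s * a"
  shows "cpos (s * a * s)"
proof -
  have "a * s * s = s * a * s" "s * (a * s) = s * (s * a)" by (simp_all only: assms(3))
  then have "a * (s * s) = s * a * s" "s * s * a = s * a * s" by (simp_all only: mult.assoc)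
  then show ?thesis
    using cpos_mult_commute[OF assms(1) cpos_square[OF assms(2)]] by simp
qed

section \<open>Invertibility\<close>

lemma invertible_eltI: "x * y = 1 \<Longrightarrow> z * x = 1 \<Longrightarrow> invertible_elt x"
  unfolding invertible_elt_def by (metis mult.assoc mult_1_left mult_1_right)

lemma invertible_elt_1 [simp]: "invertible_elt 1"
  by (rule invertible_eltI[of _ 1 1]) simp_all

lemma invertible_elt_mult: "invertible_elt x \<Longrightarrow> invertible_elt y \<Longrightarrow> invertible_elt (x * y)"
  unfolding invertible_elt_def by (metis mult.assoc mult_1_left)

lemma invertible_elt_star:
  assumes "invertible_elt (x::'a::unital_cstar_algebra)"
  shows "invertible_elt (x\<^sup>\<star>)"
proof -
  obtain y where "x * y = 1" "y * x = 1" using assms by (auto simp: invertible_elt_def)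
  then have "x\<^sup>\<star> * y\<^sup>\<star> = 1" "y\<^sup>\<star> * x\<^sup>\<star> = 1" by (metis star_mult star_one)+
  then show ?thesis by (rule invertible_eltI)
qed

lemma invertible_elt_scaleR: "r \<noteq> 0 \<Longrightarrow> invertible_elt x \<Longrightarrow> invertible_elt (r *\<^sub>R x)"
  unfolding invertible_elt_def by (metis (no_types) mult_scaleR_left mult_scaleR_right
    right_inverse scaleR_one scaleR_scaleR)

text \<open>Right and left inverses are fixed points of the contractions
  \<open>y \<mapsto> 1 + z * y\<close> and \<open>y \<mapsto> 1 + y * z\<close>; the bound follows
  from \<open>y - 1 = z * y\<close>.\<close>

lemma invertible_elt_near_one:
  fixes x :: "'a::unital_cstar_algebra"
  assumes "norm (1 - x) < 1"
  obtains y where "x * y = 1" "y * x = 1" "norm (y - 1) \<le> norm (1 - x) / (1 - norm (1 - x))"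
proof -
  define z where "z = 1 - x"
  have z: "0 \<le> norm z" "norm z < 1" using assms by (simp_all add: z_def)
  have "\<exists>!y. 1 + z * y = y"
  proof (rule banach_fix_type[OF z], intro allI)
    fix u v
    show "dist (1 + z * u) (1 + z * v) \<le> norm z * dist u v"
      using norm_mult_ineq[of z "u - v"] by (simp add: dist_norm right_diff_distrib)
  qed
  then obtain y where y: "1 + z * y = y" by blast
  have "\<exists>!y. 1 + y * z = y"
  proof (rule banach_fix_type[OF z], intro allI)
    fix u v
    show "dist (1 + u * z) (1 + v * z) \<le> norm z * dist u v"
      using norm_mult_ineq[of "u - v" z] by (simp add: dist_norm left_diff_distrib mult.commute)
  qed
  then obtain y' where y': "1 + y' * z = y'" by blast
  have xy: "x * y = 1" using y by (simp add: z_def algebra_simps)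
  have "y' * x = 1" using y' by (simp add: z_def algebra_simps)
  then have yx: "y * x = 1" using xy by (metis mult.assoc mult_1_left mult_1_right)
  have "y - 1 = z * y" using y by (metis add_diff_cancel_left')
  then have "norm (y - 1) \<le> norm z * norm y" using norm_mult_ineq[of z y] by simp
  also have "\<dots> \<le> norm z * (norm (y - 1) + 1)"
    using norm_triangle_ineq[of "y - 1" 1] by (intro mult_left_mono) simp_all
  finally have "norm (y - 1) * (1 - norm z) \<le> norm z" by (simp add: algebra_simps)
  then have "norm (y - 1) \<le> norm z / (1 - norm z)" using z by (simp add: le_divide_eq)
  then show ?thesis using that xy yx by (simp add: z_def)
qed

lemma invertible_elt_near_1: "norm (1 - (x::'a::unital_cstar_algebra)) < 1 \<Longrightarrow> invertible_elt x"
  by (erule invertible_elt_near_one) (rule invertible_eltI)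

text \<open>If \<open>y\<close> inverts \<open>1 + a * b\<close>, then \<open>1 - b * y * a\<close>
  inverts \<open>1 + b * a\<close>.\<close>

lemma invertible_elt_one_plus_commute:
  fixes a b :: "'a::unital_cstar_algebra"
  assumes "invertible_elt (1 + a * b)"
  shows "invertible_elt (1 + b * a)"
proof -
  obtain y where y: "(1 + a * b) * y = 1" "y * (1 + a * b) = 1"
    using assms by (auto simp: invertible_elt_def)
  have y': "y + a * b * y = 1" "y + y * a * b = 1" using y by (simp_all add: algebra_simps)
  have "(1 + b * a) * (1 - b * y * a) = 1 + b * a - b * (y + a * b * y) * a"
    by (simp add: algebra_simps)
  moreover have "(1 - b * y * a) * (1 + b * a) = 1 + b * a - b * (y + y * a * b) * a"
    by (simp add: algebra_simps)
  ultimately show ?thesis unfolding y' by (intro invertible_eltI) simp_all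
qed

section \<open>Inverses and spectral bounds of positive elements\<close>

lemma inverse_commutes:
  fixes Q g z :: "'a::monoid_mult"
  assumes "Q * g = 1" "g * Q = 1" "z * Q = Q * z"
  shows "z * g = g * z"
  by (metis assms mult.assoc mult_1_left mult_1_right)

lemma cpos_inverse:
  assumes "cpos Q" "Q * g = 1" "g * Q = 1"
  shows "cpos g"
proof -
  have "g\<^sup>\<star> * Q = 1" using assms cpos_star[OF assms(1)] by (metis star_mult star_one)
  then have "g\<^sup>\<star> = g" using assms(2) by (metis mult.assoc mult_1_left mult_1_right)
  then have "cpos (g * Q * g)" using assms by (intro cpos_conj_self_adjoint) simp_all
  then show ?thesis using assms by simp
qed

text \<open>Divided by \<open>t + s\<close>, the element is within \<open>s / (t + s) < 1\<close> of
  1. The norm bound holds because \<open>1 - t *\<^sub>R g = p * g\<close> is positive.\<close>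

lemma cpos_add_scalar_inverse:
  fixes p :: "'a::unital_cstar_algebra"
  assumes p: "cpos p" and t: "0 < t"
  obtains g where "(t *\<^sub>R 1 + p) * g = 1" "g * (t *\<^sub>R 1 + p) = 1" "cpos g" "norm (t *\<^sub>R g) \<le> 1"
    "\<And>y. y * p = p * y \<Longrightarrow> y * g = g * y"
proof -
  let ?Q = "t *\<^sub>R 1 + p"
  obtain s where s: "s \<ge> 0" "norm (s *\<^sub>R 1 - p) \<le> s" using p by (auto simp: cpos_def)
  have "1 - ?Q /\<^sub>R (t + s) = (s *\<^sub>R 1 - p) /\<^sub>R (t + s)"
  proof -
    have "(1::'a) = ((t + s) *\<^sub>R 1) /\<^sub>R (t + s)" using s t by simp
    then have "1 - ?Q /\<^sub>R (t + s) = ((t + s) *\<^sub>R 1 - ?Q) /\<^sub>R (t + s)"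
      by (metis scaleR_diff_right)
    then show ?thesis by (simp add: algebra_simps)
  qed
  then have "norm (1 - ?Q /\<^sub>R (t + s)) < 1"
    using s t by (simp add: divide_less_eq flip: divide_inverse_commute)
  then have "invertible_elt ((t + s) *\<^sub>R (?Q /\<^sub>R (t + s)))"
    using s t by (intro invertible_elt_scaleR invertible_elt_near_1) simp_all
  then have "invertible_elt ?Q" using s t by simp
  then obtain g where g: "?Q * g = 1" "g * ?Q = 1" by (auto simp: invertible_elt_def)
  have gp: "cpos g" using p t by (intro cpos_inverse[OF _ g] cpos_add cpos_scalar) simp_all
  have comm: "y * g = g * y" if "y * p = p * y" for y
    by (rule inverse_commutes[OF g]) (use that in \<open>simp add: algebra_simps\<close>)
  have "cpos (p * g)" using comm[of p] by (intro cpos_mult_commute p gp) simp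
  moreover have "1 - t *\<^sub>R g = p * g" using g(1) by (simp add: algebra_simps)
  ultimately have "norm (t *\<^sub>R g) \<le> norm (1::'a)"
    using gp t by (intro cpos_norm_le cpos_scaleR) simp_all
  then show ?thesis using that g gp comm by simp
qed

lemma cpos_add_scalar_invertible: "cpos p \<Longrightarrow> 0 < t \<Longrightarrow> invertible_elt (t *\<^sub>R 1 + p)"
  by (erule (1) cpos_add_scalar_inverse) (rule invertible_eltI)

lemma cpos_one_plus_invertible: "cpos p \<Longrightarrow> invertible_elt (1 + p)"
  using cpos_add_scalar_invertible[of p 1] by simp

text \<open>An inverse bounded by \<open>M\<close> would give \<open>norm q - q \<ge> 1 / M\<close>,
  so \<open>q \<le> norm q - 1 / M\<close>, against monotonicity of the norm. Thus
  \<open>norm q\<close> lies in the spectrum.\<close>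

lemma cpos_norm_diff_not_invertible:
  assumes q: "cpos q" "q \<noteq> 0"
  shows "\<not> invertible_elt (norm q *\<^sub>R 1 - q)"
proof
  let ?Q = "norm q *\<^sub>R 1 - q"
  assume "invertible_elt ?Q"
  then obtain g where g: "?Q * g = 1" "g * ?Q = 1" by (auto simp: invertible_elt_def)
  have Q: "cpos ?Q" using q by (intro cpos_one_minus cpos_star) simp_all
  have gp: "cpos g" by (rule cpos_inverse[OF Q g])
  \<comment> \<open>The second bound keeps the scalar \<open>norm q - inverse M\<close> nonnegative,
    hence equal to its norm.\<close>
  define M where "M = max (norm g) (inverse (norm q))"
  have M: "norm g \<le> M" "inverse (norm q) \<le> M" by (simp_all add: M_def)
  have iq: "0 < inverse (norm q)" using q by simp
  then have M0: "0 < M" using M by linarith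
  have Mq: "inverse M \<le> norm q" using le_imp_inverse_le[OF M(2) iq] by simp
  have "cpos (M *\<^sub>R 1 - g)" using M gp by (intro cpos_one_minus cpos_star) simp_all
  then have "cpos ((M *\<^sub>R 1 - g) * ?Q)"
    by (rule cpos_mult_commute[OF _ Q]) (use g in \<open>simp add: algebra_simps\<close>)
  then have "cpos (inverse M *\<^sub>R ((M *\<^sub>R 1 - g) * ?Q))" using M0 by (intro cpos_scaleR) simp_all
  also have "inverse M *\<^sub>R ((M *\<^sub>R 1 - g) * ?Q) = (norm q - inverse M) *\<^sub>R 1 - q"
  proof -
    have "(M *\<^sub>R 1 - g) * ?Q = M *\<^sub>R ?Q - 1" using g by (simp add: algebra_simps)
    then show ?thesis using M0 by (simp add: scaleR_diff_right) (simp add: algebra_simps)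
  qed
  finally have "norm q \<le> norm ((norm q - inverse M) *\<^sub>R (1::'a))" by (rule cpos_norm_le[OF q(1)])
  then show False using M0 Mq by simp
qed

section \<open>Positive and negative parts\<close>

text \<open>\<open>b * a\<close> times its adjoint is \<open>b * (a * a) * b\<^sup>\<star>\<close>,
  so the C*-identity applies.\<close>

lemma self_adjoint_mult_eq_0:
  fixes a b :: "'a::cstar_algebra"
  assumes "a\<^sup>\<star> = a" "b * (a * a) = 0"
  shows "b * a = 0"
proof -
  have "((b * a)\<^sup>\<star>)\<^sup>\<star> * (b * a)\<^sup>\<star> = 0"
    using assms by (simp add: star_simps) (metis mult.assoc mult_zero_left)
  then have "norm ((b * a)\<^sup>\<star>) = 0" using cstar_identity[of "(b * a)\<^sup>\<star>"] by simp
  then show ?thesis by simp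
qed

lemma cpos_add_eq_0:
  assumes "cpos a" "cpos b" "a + b = 0"
  shows "a = 0"
  using assms cpos_antisym[of a] by (metis add_eq_0_iff)

text \<open>The expected parts are \<open>P\<close> and \<open>N\<close>, with \<open>s\<close> as
  modulus of \<open>b\<close>, but their positivity is not directly visible. So the positive roots
  \<open>p\<close>, \<open>n\<close> of their squares are taken and then shown to satisfy
  \<open>s = p + n\<close> and \<open>b = p - n\<close>.\<close>

lemma cpos_parts:
  fixes b :: "'a::unital_cstar_algebra"
  assumes b: "b\<^sup>\<star> = b"
  obtains p n where "cpos p" "cpos n" "b = p - n" "p * n = 0" "n * p = 0"
    "\<And>y. y * b = b * y \<Longrightarrow> y * p = p * y" "\<And>y. y * b = b * y \<Longrightarrow> y * n = n * y"
proof -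
  obtain s where s: "s\<^sup>\<star> = s" "cpos s" "s * s = b * b" and
    sc: "\<And>y. y * (b * b) = (b * b) * y \<Longrightarrow> y * s = s * y"
    using cpos_sqrt[OF cpos_square[OF b]] by metis
  have sc': "y * s = s * y" if "y * b = b * y" for y using sc that by (metis mult.assoc)
  have sb: "s * b = b * s" using sc'[of b] by simp
  define P N where "P = (s + b) /\<^sub>R 2" and "N = (s - b) /\<^sub>R 2"
  have PN: "P\<^sup>\<star> = P" "N\<^sup>\<star> = N" using s b by (simp_all add: P_def N_def star_simps)
  have PN0: "P * N = 0" "N * P = 0" using s sb by (simp_all add: P_def N_def algebra_simps)
  have Pc: "y * P = P * y" "y * N = N * y" if "y * b = b * y" for y
    using sc'[OF that] that by (simp_all add: P_def N_def algebra_simps)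
  obtain p where p: "p\<^sup>\<star> = p" "cpos p" "p * p = P * P" and
    pc0: "\<And>y. y * (P * P) = (P * P) * y \<Longrightarrow> y * p = p * y"
    using cpos_sqrt[OF cpos_square[OF PN(1)]] by metis
  obtain n where n: "n\<^sup>\<star> = n" "cpos n" "n * n = N * N" and
    nc0: "\<And>y. y * (N * N) = (N * N) * y \<Longrightarrow> y * n = n * y"
    using cpos_sqrt[OF cpos_square[OF PN(2)]] by metis
  have pc: "y * p = p * y" if "y * b = b * y" for y using pc0 Pc(1)[OF that] by (metis mult.assoc)
  have nc: "y * n = n * y" if "y * b = b * y" for y using nc0 Pc(2)[OF that] by (metis mult.assoc)
  have bp: "b * p = p * b" "b * n = n * b" using pc[of b] nc[of b] by simp_all
  have sp: "p * s = s * p" "n * s = s * n" using sc' bp by auto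
  have pn: "p * n = n * p" using nc bp(1) by simp
  have "p * (n * n) = 0"
  proof -
    have "p * p * (n * n) = 0" using p(3) n(3) PN0 by (metis mult.assoc mult_zero_left mult_zero_right)
    then have "(n * n) * (p * p) = 0" using pn by (metis mult.assoc)
    then have "(n * n) * p = 0" by (rule self_adjoint_mult_eq_0[OF p(1)])
    then show ?thesis using pn by (metis mult.assoc)
  qed
  then have pn0: "p * n = 0" by (rule self_adjoint_mult_eq_0[OF n(1)])
  then have np0: "n * p = 0" using pn by simp
  have s_sq: "s * s = (p + n) * (p + n)"
  proof -
    have "s = P + N" by (simp add: P_def N_def algebra_simps flip: scaleR_add_left)
    then have "s * s = P * P + N * N" using PN0 by (simp add: algebra_simps)
    then show ?thesis using p n pn0 np0 by (simp add: algebra_simps)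
  qed
  \<comment> \<open>Uniqueness of the root: \<open>s\<close> and \<open>p + n\<close> commute and
    have equal squares, so the positive \<open>d * s * d\<close> and \<open>d * (p + n) * d\<close>
    add up to 0. Both vanish, and their difference is the cube of \<open>d\<close>.\<close>
  define d where "d = s - (p + n)"
  have ds: "d\<^sup>\<star> = d" using s p n by (simp add: d_def star_simps)
  have dc: "s * d = d * s" "(p + n) * d = d * (p + n)"
    using sp pn by (simp_all add: d_def algebra_simps)
  have "d * (s + (p + n)) = 0"
    using s_sq sp by (simp add: d_def algebra_simps)
  then have "d * s * d + d * (p + n) * d = 0"
    by (metis distrib_left distrib_right mult_zero_left)
  moreover have c: "cpos (d * s * d)" "cpos (d * (p + n) * d)"
    using s p n dc ds by (auto intro!: cpos_conj_self_adjoint cpos_add)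
  ultimately have "d * s * d = 0" "d * (p + n) * d = 0"
    using cpos_add_eq_0 by (metis, metis add.commute)
  then have "d * d * d = 0" by (metis d_def left_diff_distrib right_diff_distrib diff_zero)
  then have "(d * d) * (d * d) = 0" by (metis mult.assoc mult_zero_left)
  then have "d * d = 0" by (rule self_adjoint_square_eq_0[rotated]) (simp add: ds star_mult)
  then have "d = 0" by (rule self_adjoint_square_eq_0[OF ds])
  then have spn: "s = p + n" by (simp add: d_def)
  \<comment> \<open>Both \<open>b\<close> and \<open>p - n\<close> have square \<open>s * s\<close>,
    so \<open>e * s = 0\<close> makes \<open>e\<close> annihilate each of them and hence
    itself.\<close>
  define e where "e = b - (p - n)"
  have es: "e\<^sup>\<star> = e" using b p n by (simp add: e_def star_simps)
  have "b * s = P * P - N * N"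
    using s(3) sb by (simp add: P_def N_def algebra_simps flip: scaleR_add_left)
  also have "\<dots> = (p - n) * s" using p n pn0 np0 by (simp add: spn algebra_simps)
  finally have es0: "e * s = 0" by (simp add: e_def algebra_simps)
  then have "e * (b * b) = 0" using s(3) by (metis mult.assoc mult_zero_left)
  then have eb: "e * b = 0" by (rule self_adjoint_mult_eq_0[OF b])
  have "(p - n) * (p - n) = s * s" using s_sq pn0 np0 by (simp add: algebra_simps)
  then have "e * ((p - n) * (p - n)) = 0" using es0 by (metis mult.assoc mult_zero_left)
  then have "e * (p - n) = 0" by (rule self_adjoint_mult_eq_0[rotated]) (simp add: p n star_simps)
  then have "e * e = 0" using eb by (simp add: e_def right_diff_distrib)
  then have "e = 0" by (rule self_adjoint_square_eq_0[OF es])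
  then have "b = p - n" by (simp add: e_def)
  then show ?thesis using that p n pn0 np0 pc nc by blast
qed

text \<open>With \<open>d\<^sup>\<star> d = p - n\<close> and \<open>e = d n\<close> one has \<open>e\<^sup>\<star> e = - n\<^sup>3\<close>, while
  \<open>e e\<^sup>\<star> = 2 u\<^sup>2 + 2 v\<^sup>2 - e\<^sup>\<star> e\<close> is positive for the real and imaginary parts \<open>u, v\<close> of \<open>e\<close>.
  Comparing the invertibility of \<open>t + e\<^sup>\<star> e\<close> and \<open>t + e e\<^sup>\<star>\<close> forces \<open>n = 0\<close>.\<close>

lemma cpos_star_mult: "cpos (d\<^sup>\<star> * (d::'a::unital_cstar_algebra))"
proof -
  have "(d\<^sup>\<star> * d)\<^sup>\<star> = d\<^sup>\<star> * d" by (simp add: star_simps)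
  then obtain p n where p: "cpos p" and n: "cpos n" and pn: "d\<^sup>\<star> * d = p - n" "p * n = 0" "n * p = 0"
    by (rule cpos_parts) metis
  define e where "e = d * n"
  define q where "q = n * n * n"
  have ns: "n\<^sup>\<star> = n" by (rule cpos_star[OF n])
  have qp: "cpos q" unfolding q_def by (rule cpos_conj_self_adjoint[OF n ns]) simp
  have "e\<^sup>\<star> * e = n * (d\<^sup>\<star> * d) * n" by (simp add: e_def star_mult ns mult.assoc)
  then have e1: "e\<^sup>\<star> * e = - q" unfolding pn(1) q_def using pn(3) by (simp add: algebra_simps)
  define u v where "u = (e + e\<^sup>\<star>) /\<^sub>R 2" and "v = (1/2) *\<^sub>R (\<i> *\<^sub>C (e\<^sup>\<star> - e))"
  have us: "u\<^sup>\<star> = u" by (simp add: u_def star_simps add.commute)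
  have vs: "v\<^sup>\<star> = v"
  proof -
    have "(\<i> *\<^sub>C (e\<^sup>\<star> - e))\<^sup>\<star> = - (\<i> *\<^sub>C (- (e\<^sup>\<star> - e)))"
      by (simp only: star_scaleC star_diff star_star minus_diff_eq complex_cnj_i scaleC_minus_left)
    then show ?thesis by (simp only: v_def star_scaleR scaleC_minus_right minus_minus)
  qed
  have "4 *\<^sub>R (v * v) = \<i> *\<^sub>C (\<i> *\<^sub>C ((e\<^sup>\<star> - e) * (e\<^sup>\<star> - e)))"
    by (simp add: v_def mult_scaleC_left mult_scaleC_right scaleC_scaleR)
  then have v2: "4 *\<^sub>R (v * v) = - ((e\<^sup>\<star> - e) * (e\<^sup>\<star> - e))" by (simp only: scaleC_ii)
  have u2: "4 *\<^sub>R (u * u) = (e + e\<^sup>\<star>) * (e + e\<^sup>\<star>)" by (simp add: u_def)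
  have "4 *\<^sub>R (u * u) + 4 *\<^sub>R (v * v) = 2 *\<^sub>R (e\<^sup>\<star> * e + e * e\<^sup>\<star>)"
    unfolding u2 v2 by (simp add: algebra_simps scaleR_2)
  then have "2 *\<^sub>R (2 *\<^sub>R (u * u) + 2 *\<^sub>R (v * v)) = 2 *\<^sub>R (e\<^sup>\<star> * e + e * e\<^sup>\<star>)"
    by (simp add: scaleR_add_right)
  then have "2 *\<^sub>R (u * u) + 2 *\<^sub>R (v * v) = e\<^sup>\<star> * e + e * e\<^sup>\<star>" by simp
  then have "e * e\<^sup>\<star> = 2 *\<^sub>R (u * u) + 2 *\<^sub>R (v * v) + q" by (simp add: e1 algebra_simps)
  then have ee: "cpos (e * e\<^sup>\<star>)"
    using us vs qp by (auto intro!: cpos_add cpos_scaleR cpos_square)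
  have "q = 0"
  proof (rule ccontr)
    assume q0: "q \<noteq> 0"
    let ?r = "inverse (norm q)"
    have "invertible_elt (1 + e * (?r *\<^sub>R e\<^sup>\<star>))"
      using cpos_one_plus_invertible[OF cpos_scaleR[OF ee, of ?r]] by simp
    then have "invertible_elt (1 + (?r *\<^sub>R e\<^sup>\<star>) * e)" by (rule invertible_elt_one_plus_commute)
    then have "invertible_elt (norm q *\<^sub>R (1 - ?r *\<^sub>R q))"
      using q0 by (intro invertible_elt_scaleR) (simp_all add: e1)
    then have "invertible_elt (norm q *\<^sub>R 1 - q)" using q0 by (simp add: scaleR_diff_right)
    then show False using cpos_norm_diff_not_invertible[OF qp q0] by simp
  qed
  then have "(n * n) * (n * n) = 0" by (simp add: q_def mult.assoc)
  then have "n * n = 0" by (rule self_adjoint_square_eq_0[rotated]) (simp add: ns star_mult)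
  then have "n = 0" by (rule self_adjoint_square_eq_0[OF ns])
  then show ?thesis using p by (simp add: pn(1))
qed

lemma cpos_conj:
  assumes "cpos a"
  shows "cpos (d\<^sup>\<star> * a * d)"
proof -
  obtain s where s: "s\<^sup>\<star> = s" "s * s = a" using cpos_sqrt[OF assms] by metis
  have "d\<^sup>\<star> * a * d = (s * d)\<^sup>\<star> * (s * d)" using s by (simp add: star_mult flip: s(2)) (simp add: mult.assoc)
  then show ?thesis using cpos_star_mult by simp
qed

text \<open>For \<open>a = m * m\<close> and \<open>c = g * g\<close>, the element
  \<open>c - a\<close> is minus the product of \<open>g + m\<close> and \<open>- g + m\<close>, both
  invertible when \<open>Im g \<noteq> 0\<close>.\<close>

lemma cpos_imp_positive_elts:
  assumes "cpos (a::'a::unital_cstar_algebra)"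
  shows "a \<in> positive_elts"
proof -
  obtain m where m: "m\<^sup>\<star> = m" "m * m = a" using cpos_sqrt[OF assms] by metis
  \<comment> \<open>The product with the conjugate factor is \<open>(Im g)\<^sup>2 + h * h\<close>,
    a positive scalar plus a positive element.\<close>
  have r: "invertible_elt (g *\<^sub>C 1 + m)" if g: "Im g \<noteq> 0" for g :: complex
  proof -
    define h where "h = Re g *\<^sub>R 1 + m"
    have hs: "h\<^sup>\<star> = h" by (simp add: h_def star_simps m)
    have gd: "g *\<^sub>C 1 + m = h + \<i> *\<^sub>C (Im g *\<^sub>R 1)"
      unfolding h_def by (subst complex_eq[of g])
        (simp add: scaleC_add_left scaleR_scaleC scaleC_scaleC mult.commute)
    have f: "(h + \<i> *\<^sub>C (Im g *\<^sub>R 1)) * (h - \<i> *\<^sub>C (Im g *\<^sub>R 1)) = (Im g)\<^sup>2 *\<^sub>R 1 + h * h"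
      "(h - \<i> *\<^sub>C (Im g *\<^sub>R 1)) * (h + \<i> *\<^sub>C (Im g *\<^sub>R 1)) = (Im g)\<^sup>2 *\<^sub>R 1 + h * h"
      by (simp_all add: algebra_simps mult_scaleC_left mult_scaleC_right scaleC_ii scaleC_scaleR
        scaleC_add_right scaleC_diff_right power2_eq_square)
    have "invertible_elt ((Im g)\<^sup>2 *\<^sub>R 1 + h * h)"
      using g by (intro cpos_add_scalar_invertible cpos_square hs) simp
    then obtain y where y: "((Im g)\<^sup>2 *\<^sub>R 1 + h * h) * y = 1" "y * ((Im g)\<^sup>2 *\<^sub>R 1 + h * h) = 1"
      by (auto simp: invertible_elt_def)
    have "(h + \<i> *\<^sub>C (Im g *\<^sub>R 1)) * ((h - \<i> *\<^sub>C (Im g *\<^sub>R 1)) * y) = 1"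
      by (simp only: f y flip: mult.assoc)
    moreover have "(y * (h - \<i> *\<^sub>C (Im g *\<^sub>R 1))) * (h + \<i> *\<^sub>C (Im g *\<^sub>R 1)) = 1"
      by (simp only: f y mult.assoc)
    ultimately show ?thesis unfolding gd by (rule invertible_eltI)
  qed
  have "c \<in> complex_of_real ` {0..}" if c: "\<not> invertible_elt (c *\<^sub>C 1 - a)" for c
  proof (rule ccontr)
    assume n: "c \<notin> complex_of_real ` {0..}"
    define g where "g = csqrt c"
    have g2: "g * g = c" by (simp add: g_def flip: power2_eq_square)
    have "Im g \<noteq> 0"
    proof
      assume "Im g = 0"
      then have "c = complex_of_real (Re g * Re g)" using g2 by (metis complex_is_Real_iff of_real_Re of_real_mult)
      then show False using n by (metis atLeast_iff imageI zero_le_square)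
    qed
    then have "invertible_elt (g *\<^sub>C 1 + m)" "invertible_elt ((- g) *\<^sub>C 1 + m)"
      by (auto intro!: r)
    then have "invertible_elt ((-1) *\<^sub>R ((g *\<^sub>C 1 + m) * ((- g) *\<^sub>C 1 + m)))"
      by (intro invertible_elt_scaleR invertible_elt_mult) simp_all
    also have "(-1) *\<^sub>R ((g *\<^sub>C 1 + m) * ((- g) *\<^sub>C 1 + m)) = c *\<^sub>C 1 - a"
      by (simp add: scaleC_minus_left algebra_simps mult_scaleC_left mult_scaleC_right
          scaleC_add_right scaleC_scaleC g2 m)
    finally show False using c by simp
  qed
  then show ?thesis using cpos_star[OF assms] by (auto simp: positive_elts_def spectrum_def)
qed

section \<open>Projections and homomorphisms\<close>

lemma norm_projection_le_1:
  assumes "is_projection p"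
  shows "norm p \<le> 1"
proof -
  have "norm p * norm p = norm p"
    using assms norm_self_adjoint_square[of p] by (simp add: is_projection_def power2_eq_square)
  then show ?thesis by auto
qed

text \<open>A self-adjoint contraction \<open>x\<close> has a commuting \<open>h\<close> with
  \<open>x * x + h * h = 1\<close>; the squares of the images add up to the projection
  \<open>f 1\<close>, of norm at most 1. The C*-identity reduces to self-adjoint elements.\<close>

lemma norm_star_hom_le:
  fixes f :: "'b::unital_cstar_algebra \<Rightarrow> 'a::cstar_algebra"
  assumes f: "star_hom f"
  shows "norm (f b) \<le> norm b"
proof -
  have fh: "f (x + y) = f x + f y" "f (c *\<^sub>C x) = c *\<^sub>C f x" "f (x * y) = f x * f y"
    "f (x\<^sup>\<star>) = (f x)\<^sup>\<star>" for x y c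
    using f by (auto simp: star_hom_def)
  have fR: "f (r *\<^sub>R x) = r *\<^sub>R f x" for r x by (simp add: scaleR_scaleC fh)
  have pr: "is_projection (f 1)" unfolding is_projection_def
    by (simp flip: fh(3) fh(4))
  have *: "norm (f x) \<le> 1" if x: "x\<^sup>\<star> = x" "norm x \<le> 1" for x
  proof -
    have "norm (x * x) \<le> 1" using x by (simp add: norm_self_adjoint_square power_le_one)
    then obtain h where h: "h\<^sup>\<star> = h" "h * h = 1 - x * x"
      "\<And>y. y * (x * x) = (x * x) * y \<Longrightarrow> y * h = h * y"
      using sqrt_one_minus[of "x * x"] x by (metis star_mult)
    have xh: "x * h = h * x" by (rule h(3)) (simp add: mult.assoc)
    have "(norm (f x))\<^sup>2 \<le> norm (f x * f x + f h * f h)"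
      using x h(1) xh by (intro norm_sq_le_of_commuting_squares) (simp_all flip: fh)
    also have "\<dots> = norm (f 1)" using h(2) by (simp flip: fh)
    also have "\<dots> \<le> 1" by (rule norm_projection_le_1[OF pr])
    finally show ?thesis by (simp add: power_le_one_iff abs_square_le_1)
  qed
  have sa: "norm (f x) \<le> norm x" if x: "x\<^sup>\<star> = x" for x
  proof (cases "x = 0")
    case True
    then show ?thesis using fR[of 0 0] by simp
  next
    case False
    have "norm (f (x /\<^sub>R norm x)) \<le> 1" using x False by (intro *) (simp_all add: star_simps)
    then show ?thesis using False by (simp add: fR divide_le_eq flip: divide_inverse_commute)
  qed
  have "(norm (f b))\<^sup>2 = norm (f (b\<^sup>\<star> * b))" by (simp add: fh cstar_identity)
  also have "\<dots> \<le> norm (b\<^sup>\<star> * b)" by (rule sa) (simp add: star_simps)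
  also have "\<dots> = (norm b)\<^sup>2" by (simp add: cstar_identity)
  finally show ?thesis by (simp add: power2_le_iff_abs_le)
qed

section \<open>Stable rank one\<close>

lemma stable_rank_oneD:
  fixes x :: "'a::unital_cstar_algebra"
  assumes "stable_rank_one TYPE('a)" "0 < e"
  obtains y where "invertible_elt y" "norm (y - x) < e"
proof -
  have "x \<in> closure {x :: 'a. invertible_elt x}" using assms by (simp add: stable_rank_one_def)
  then show ?thesis using that assms(2) by (auto simp: closure_approachable dist_norm)
qed

lemma stable_rank_oneI:
  assumes "\<And>(x::'a::unital_cstar_algebra) e. 0 < e \<Longrightarrow> \<exists>y. invertible_elt y \<and> norm (y - x) < e"
  shows "stable_rank_one TYPE('a)"
proof -
  have "x \<in> closure {x :: 'a. invertible_elt x}" for x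
    unfolding closure_approachable using assms[of _ x] by (force simp: dist_norm)
  then show ?thesis by (auto simp: stable_rank_one_def)
qed

text \<open>An invertible \<open>y\<close> near the isometry \<open>v\<close> makes
  \<open>v\<^sup>\<star> * y\<close> invertible, hence \<open>v\<^sup>\<star>\<close>, whose right
  inverse \<open>v\<close> is then its inverse.\<close>

lemma stable_rank_one_imp_finite:
  assumes sr: "stable_rank_one TYPE('a::unital_cstar_algebra)"
  shows "finite_cstar TYPE('a)"
  unfolding finite_cstar_def
proof (intro allI impI)
  fix v :: 'a assume v: "v\<^sup>\<star> * v = 1"
  then have "(norm v)\<^sup>2 = 1" using cstar_identity[of v] by simp
  then have nv: "norm v = 1" unfolding power2_eq_1_iff using norm_ge_zero[of v] by linarith
  obtain y where y: "invertible_elt y" "norm (y - v) < 1" by (rule stable_rank_oneD[OF sr, of 1]) simp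
  have "1 - v\<^sup>\<star> * y = v\<^sup>\<star> * (v - y)" using v by (simp add: algebra_simps)
  then have "norm (1 - v\<^sup>\<star> * y) < 1"
    using norm_mult_ineq[of "v\<^sup>\<star>" "v - y"] y nv by (simp add: norm_minus_commute)
  then have "invertible_elt (v\<^sup>\<star> * y)" by (rule invertible_elt_near_1)
  moreover obtain z where z: "y * z = 1" "z * y = 1" using y by (auto simp: invertible_elt_def)
  moreover have "invertible_elt z" using z(2,1) by (rule invertible_eltI)
  ultimately have "invertible_elt (v\<^sup>\<star> * y * z)" by (blast intro: invertible_elt_mult)
  then have "invertible_elt (v\<^sup>\<star>)" using z by (simp add: mult.assoc)
  then obtain w where "w * v\<^sup>\<star> = 1" "v\<^sup>\<star> * w = 1" by (auto simp: invertible_elt_def)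
  then show "v * v\<^sup>\<star> = 1" using v by (metis mult.assoc mult_1_left mult_1_right)
qed

lemma tendsto_inverse_near_one:
  fixes P :: "nat \<Rightarrow> 'a::unital_cstar_algebra"
  assumes P: "P \<longlonglongrightarrow> 1"
  obtains L where "L \<longlonglongrightarrow> 1" "\<forall>\<^sub>F n in sequentially. P n * L n = 1 \<and> L n * P n = 1"
proof -
  \<comment> \<open>Within distance 1/2 the denominator is at least 1/2, whence the factor 2;
    elsewhere the default \<open>l = 1\<close> meets the bound.\<close>
  have "\<exists>l. norm (l - 1) \<le> 2 * norm (1 - P n) \<and> (norm (1 - P n) < 1/2 \<longrightarrow> P n * l = 1 \<and> l * P n = 1)" for n
  proof (cases "norm (1 - P n) < 1/2")
    case True
    then have "norm (1 - P n) < 1" by simp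
    then obtain l where l: "P n * l = 1" "l * P n = 1"
      "norm (l - 1) \<le> norm (1 - P n) / (1 - norm (1 - P n))"
      by (rule invertible_elt_near_one)
    have "norm (1 - P n) / (1 - norm (1 - P n)) \<le> norm (1 - P n) / (1/2)"
      using True by (intro divide_left_mono) auto
    then show ?thesis using l by (intro exI[of _ l]) auto
  qed (auto intro: exI[of _ 1])
  then obtain L where L: "\<And>n. norm (L n - 1) \<le> 2 * norm (1 - P n)"
    "\<And>n. norm (1 - P n) < 1/2 \<Longrightarrow> P n * L n = 1 \<and> L n * P n = 1" by metis
  have "(\<lambda>n. norm (1 - P n)) \<longlonglongrightarrow> 0"
    using tendsto_norm[OF tendsto_diff[OF tendsto_const P, of 1]] by simp
  then have N: "(\<lambda>n. norm (1 - P n)) \<longlonglongrightarrow> 0" .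
  show ?thesis
  proof
    have "(\<lambda>n. L n - 1) \<longlonglongrightarrow> 0"
      by (rule Lim_null_comparison[OF always_eventually[OF allI[OF L(1)]]])
        (use tendsto_mult_right_zero[OF N, of 2] in simp)
    then show "L \<longlonglongrightarrow> 1" by (simp add: LIM_zero_iff)
    show "\<forall>\<^sub>F n in sequentially. P n * L n = 1 \<and> L n * P n = 1"
      using order_tendstoD(2)[OF N, of "1/2"] L(2) by (auto elim: eventually_mono)
  qed
qed

text \<open>A perturbation of an invertible approximant of \<open>X + \<lambda>\<close>, first from the left and then from the
  right, makes it act as the scalar \<open>\<lambda>\<close> on \<open>z1\<close>.\<close>

lemma stable_rank_one_scalar_corner:
  fixes X z1 z2 :: "'a::unital_cstar_algebra"
  assumes sr: "stable_rank_one TYPE('a)"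
    and X: "X * z2 = 0" "z2 * X = 0" and z: "z2 * z1 = z1" "z1 * z2 = z1"
    and lam: "0 < lam" and e: "0 < e"
  obtains y where "invertible_elt y" "norm (y - (X + lam *\<^sub>R 1)) < e"
    "y * z1 = lam *\<^sub>R z1" "z1 * y = lam *\<^sub>R z1"
proof -
  let ?S = "X + lam *\<^sub>R 1"
  have "\<exists>y. invertible_elt y \<and> norm (y - ?S) < 1 / real (Suc n)" for n
    by (rule stable_rank_oneD[OF sr, of "1 / real (Suc n)" ?S]) auto
  then obtain Y where Y: "\<And>n. invertible_elt (Y n)" "\<And>n. norm (Y n - ?S) < 1 / real (Suc n)" by metis
  have "(\<lambda>n. Y n - ?S) \<longlonglongrightarrow> 0"
    by (rule Lim_null_comparison[OF _ LIMSEQ_inverse_real_of_nat])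
      (use Y(2) in \<open>simp add: inverse_eq_divide less_imp_le\<close>)
  then have YS: "Y \<longlonglongrightarrow> ?S" by (simp add: LIM_zero_iff)
  \<comment> \<open>\<open>P\<close> tends to 1 because \<open>X * z2 = 0\<close>, and
    \<open>P n\<close> sends \<open>lam *\<^sub>R z1\<close> to \<open>Y n * z1\<close>; undoing it
    makes \<open>Y' n\<close> scalar on \<open>z1\<close>.\<close>
  define P where "P n = 1 + ((Y n - lam *\<^sub>R 1) * z2) /\<^sub>R lam" for n
  have "P \<longlonglongrightarrow> 1 + ((?S - lam *\<^sub>R 1) * z2) /\<^sub>R lam"
    unfolding P_def by (intro tendsto_intros YS)
  then have "P \<longlonglongrightarrow> 1" using X by simp
  then obtain L where L: "L \<longlonglongrightarrow> 1" "\<forall>\<^sub>F n in sequentially. P n * L n = 1 \<and> L n * P n = 1"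
    by (rule tendsto_inverse_near_one)
  define Y' where "Y' n = L n * Y n" for n
  have "Y' \<longlonglongrightarrow> 1 * ?S" unfolding Y'_def by (intro tendsto_intros YS L)
  then have YS': "Y' \<longlonglongrightarrow> ?S" by simp
  \<comment> \<open>The mirror correction. \<open>Q n\<close> fixes \<open>z1\<close> because
    \<open>Y' n\<close> is already scalar there, so the first correction survives.\<close>
  define Q where "Q n = 1 + (z2 * (Y' n - lam *\<^sub>R 1)) /\<^sub>R lam" for n
  have "Q \<longlonglongrightarrow> 1 + (z2 * (?S - lam *\<^sub>R 1)) /\<^sub>R lam"
    unfolding Q_def by (intro tendsto_intros YS')
  then have "Q \<longlonglongrightarrow> 1" using X by simp
  then obtain R where R: "R \<longlonglongrightarrow> 1" "\<forall>\<^sub>F n in sequentially. Q n * R n = 1 \<and> R n * Q n = 1"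
    by (rule tendsto_inverse_near_one)
  have "(\<lambda>n. Y' n * R n) \<longlonglongrightarrow> ?S * 1" by (intro tendsto_intros YS' R)
  then have "\<forall>\<^sub>F n in sequentially. dist (Y' n * R n) ?S < e" using e by (intro tendstoD) simp_all
  then have "\<forall>\<^sub>F n in sequentially. (P n * L n = 1 \<and> L n * P n = 1) \<and>
      (Q n * R n = 1 \<and> R n * Q n = 1) \<and> dist (Y' n * R n) ?S < e"
    by (intro eventually_conj[OF L(2) eventually_conj[OF R(2)]])
  then obtain n where PL: "P n * L n = 1" "L n * P n = 1" and QR: "Q n * R n = 1" "R n * Q n = 1"
    and d: "norm (Y' n * R n - ?S) < e"
    by (auto simp: eventually_sequentially dist_norm)
  have "P n * (lam *\<^sub>R z1) = Y n * z1"
  proof -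
    have "P n * (lam *\<^sub>R z1) = lam *\<^sub>R z1 + (Y n - lam *\<^sub>R 1) * (z2 * z1)"
      using lam by (simp add: P_def distrib_right scaleR_add_right mult.assoc)
    then show ?thesis using z by (simp add: algebra_simps)
  qed
  then have "L n * (P n * (lam *\<^sub>R z1)) = Y' n * z1" by (simp add: Y'_def mult.assoc)
  then have Y'z: "Y' n * z1 = lam *\<^sub>R z1" using PL by (simp flip: mult.assoc)
  have "Q n * z1 = z1"
  proof -
    have "Q n * z1 = z1 + (z2 * (Y' n * z1 - lam *\<^sub>R z1)) /\<^sub>R lam"
      by (simp add: Q_def distrib_right mult.assoc left_diff_distrib)
    then show ?thesis using Y'z by simp
  qed
  then have "R n * z1 = z1" using QR by (metis mult.assoc mult_1_left)
  then have r: "(Y' n * R n) * z1 = lam *\<^sub>R z1" using Y'z by (simp add: mult.assoc)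
  have "(lam *\<^sub>R z1) * Q n = z1 * Y' n"
  proof -
    have "(lam *\<^sub>R z1) * Q n = lam *\<^sub>R z1 + (z1 * z2) * (Y' n - lam *\<^sub>R 1)"
      using lam by (simp add: Q_def distrib_left scaleR_add_right mult.assoc)
    then show ?thesis using z by (simp add: algebra_simps)
  qed
  then have "(lam *\<^sub>R z1) * (Q n * R n) = z1 * (Y' n * R n)" by (metis mult.assoc)
  then have l: "z1 * (Y' n * R n) = lam *\<^sub>R z1" using QR by simp
  have "invertible_elt (Y' n * R n)"
    unfolding Y'_def using PL QR Y by (intro invertible_elt_mult) (auto intro: invertible_eltI)
  then show ?thesis using that d r l by blast
qed

section \<open>Approximation by zero divisors\<close>

text \<open>Polar decomposition: with \<open>s\<close> the root of the inverse of
  \<open>a\<^sup>\<star> * a\<close>, the element \<open>a * s\<close> is an isometry, hence a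
  unitary.\<close>

lemma finite_cstar_invertible:
  fixes a :: "'a::unital_cstar_algebra"
  assumes fin: "finite_cstar TYPE('a)" and inv: "invertible_elt (a\<^sup>\<star> * a)"
  shows "invertible_elt a"
proof -
  let ?h = "a\<^sup>\<star> * a"
  obtain g where g: "?h * g = 1" "g * ?h = 1" using inv by (auto simp: invertible_elt_def)
  have "cpos g" by (rule cpos_inverse[OF cpos_star_mult g])
  then obtain s where s: "s\<^sup>\<star> = s" "s * s = g" "\<And>y. y * g = g * y \<Longrightarrow> y * s = s * y"
    by (rule cpos_sqrt) metis
  have hs: "?h * s = s * ?h" by (rule s(3)) (simp only: g)
  have "(a * s)\<^sup>\<star> * (a * s) = s * (?h * s)" using s(1) by (simp add: star_mult mult.assoc)
  also have "\<dots> = s * s * ?h" unfolding hs by (simp only: mult.assoc)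
  finally have "(a * s)\<^sup>\<star> * (a * s) = 1" using s(2) g by simp
  then have "(a * s) * (a * s)\<^sup>\<star> = 1" using fin by (auto simp: finite_cstar_def)
  moreover have "(a * s) * (a * s)\<^sup>\<star> = a * ((s * s) * a\<^sup>\<star>)" using s(1) by (simp add: star_mult mult.assoc)
  ultimately have "a * (g * a\<^sup>\<star>) = 1" using s(2) by simp
  then show ?thesis by (rule invertible_eltI[of _ _ "g * a\<^sup>\<star>"]) (simp add: g mult.assoc)
qed

text \<open>With \<open>p\<close>, \<open>n\<close> the parts of
  \<open>a\<^sup>\<star> * a - e\<^sup>2\<close> and \<open>g\<close> the inverse of
  \<open>e\<^sup>2 + p\<close>, noninvertibility forces \<open>n \<noteq> 0\<close>. The cutoff
  \<open>m = p * g\<close> kills \<open>n\<close>, and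
  \<open>1 - m = e\<^sup>2 *\<^sub>R g\<close>.\<close>

lemma near_zero_divisor:
  fixes a :: "'a::unital_cstar_algebra"
  assumes "\<not> invertible_elt (a\<^sup>\<star> * a)" and e: "0 < e"
  obtains m k where "norm (a - a * m) \<le> e" "m * k = 0" "cpos k" "k \<noteq> 0"
proof -
  let ?h = "a\<^sup>\<star> * a"
  have e2: "0 < e\<^sup>2" using e by simp
  have "(?h - e\<^sup>2 *\<^sub>R 1)\<^sup>\<star> = ?h - e\<^sup>2 *\<^sub>R 1" by (simp add: star_simps)
  then obtain p n where p: "cpos p" and n: "cpos n" and pn: "?h - e\<^sup>2 *\<^sub>R 1 = p - n" "p * n = 0" "n * p = 0"
    by (rule cpos_parts) metis
  have h: "?h = e\<^sup>2 *\<^sub>R 1 + p - n" using pn(1) by (simp add: algebra_simps)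
  have "n \<noteq> 0" using assms(1) cpos_add_scalar_invertible[OF p e2] unfolding h by auto
  obtain g where g: "(e\<^sup>2 *\<^sub>R 1 + p) * g = 1" "g * (e\<^sup>2 *\<^sub>R 1 + p) = 1" "cpos g" "norm (e\<^sup>2 *\<^sub>R g) \<le> 1"
    and gc: "\<And>y. y * p = p * y \<Longrightarrow> y * g = g * y"
    using cpos_add_scalar_inverse[OF p e2] by metis
  have gs: "g\<^sup>\<star> = g" using g(3) by (rule cpos_star)
  have pg: "p * g = g * p" by (rule gc) simp
  have m: "1 - p * g = e\<^sup>2 *\<^sub>R g" using g(1) by (simp add: algebra_simps)
  \<comment> \<open>Since \<open>p * n = 0\<close>, \<open>e\<^sup>2 + p\<close> acts on
    \<open>n\<close> as a scalar.\<close>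
  have gn: "e\<^sup>2 *\<^sub>R (g * n) = n"
  proof -
    have "g * (e\<^sup>2 *\<^sub>R 1 + p) * n = n" using g by simp
    then show ?thesis using pn(2) by (simp add: algebra_simps)
  qed
  \<comment> \<open>Dropping \<open>- n\<close> leaves \<open>e\<^sup>2\<close> times a
    contraction.\<close>
  have eq: "(e\<^sup>2 *\<^sub>R g)\<^sup>\<star> * ?h * (e\<^sup>2 *\<^sub>R g) = e\<^sup>2 *\<^sub>R (e\<^sup>2 *\<^sub>R g) - n"
  proof -
    have ng: "e\<^sup>2 *\<^sub>R (n * g) = n"
    proof -
      have "(e\<^sup>2 *\<^sub>R (g * n))\<^sup>\<star> = n\<^sup>\<star>" by (simp only: gn)
      then show ?thesis by (simp only: star_scaleR star_mult gs cpos_star[OF n])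
    qed
    have "(e\<^sup>2 *\<^sub>R g)\<^sup>\<star> * ?h * (e\<^sup>2 *\<^sub>R g)
        = e\<^sup>2 *\<^sub>R e\<^sup>2 *\<^sub>R ((g * (e\<^sup>2 *\<^sub>R 1 + p)) * g) - (e\<^sup>2 *\<^sub>R (g * n)) * (e\<^sup>2 *\<^sub>R g)"
      unfolding h by (simp add: star_scaleR gs algebra_simps)
    also have "\<dots> = e\<^sup>2 *\<^sub>R e\<^sup>2 *\<^sub>R g - n * (e\<^sup>2 *\<^sub>R g)" unfolding gn g by simp
    finally show ?thesis using ng by simp
  qed
  have "cpos ((e\<^sup>2 *\<^sub>R g)\<^sup>\<star> * ?h * (e\<^sup>2 *\<^sub>R g))" by (intro cpos_conj cpos_star_mult)
  then have "norm ((e\<^sup>2 *\<^sub>R g)\<^sup>\<star> * ?h * (e\<^sup>2 *\<^sub>R g)) \<le> norm (e\<^sup>2 *\<^sub>R (e\<^sup>2 *\<^sub>R g))"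
    by (rule cpos_norm_le) (unfold eq, simp add: n)
  also have "\<dots> = e\<^sup>2 * norm (e\<^sup>2 *\<^sub>R g)" by simp
  also have "\<dots> \<le> e\<^sup>2 * 1" using g(4) by (intro mult_left_mono) simp_all
  finally have le: "norm ((e\<^sup>2 *\<^sub>R g)\<^sup>\<star> * ?h * (e\<^sup>2 *\<^sub>R g)) \<le> e\<^sup>2" by simp
  have "a - a * (p * g) = a * (e\<^sup>2 *\<^sub>R g)" using m by (metis mult_1_right right_diff_distrib)
  then have "(norm (a - a * (p * g)))\<^sup>2 = norm ((e\<^sup>2 *\<^sub>R g)\<^sup>\<star> * ?h * (e\<^sup>2 *\<^sub>R g))"
    using cstar_identity[of "a * (e\<^sup>2 *\<^sub>R g)"] by (simp only: star_mult mult.assoc)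
  then have "norm (a - a * (p * g)) \<le> e" using le e by (metis power2_le_imp_le less_imp_le)
  moreover have "p * g * n = 0" unfolding pg using pn(2) by (simp add: mult.assoc)
  ultimately show ?thesis using that n \<open>n \<noteq> 0\<close> by blast
qed

text \<open>The second cutoff is made for the adjoint, so it multiplies from the left and preserves
  \<open>x * k = 0\<close>.\<close>

lemma finite_near_two_sided_zero_divisor:
  fixes a :: "'a::unital_cstar_algebra"
  assumes fin: "finite_cstar TYPE('a)" and inv: "\<not> invertible_elt a" and e: "0 < e"
  obtains x k l where "norm (a - x) \<le> e" "x * k = 0" "l * x = 0"
    "cpos k" "k \<noteq> 0" "cpos l" "l \<noteq> 0"
proof -
  have "\<not> invertible_elt (a\<^sup>\<star> * a)" using finite_cstar_invertible[OF fin] inv by blast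
  then obtain m k where m: "norm (a - a * m) \<le> e / 2" "m * k = 0" "cpos k" "k \<noteq> 0"
    using half_gt_zero[OF e] by (rule near_zero_divisor)
  define x where "x = a * m"
  have xk: "x * k = 0" using m by (simp add: x_def mult.assoc)
  have "\<not> invertible_elt x"
    using xk m(4) unfolding invertible_elt_def by (metis mult.assoc mult_1_left mult_zero_right)
  then have "\<not> invertible_elt (x\<^sup>\<star>)" using invertible_elt_star[of "x\<^sup>\<star>"] by (auto simp: star_star)
  then have "\<not> invertible_elt ((x\<^sup>\<star>)\<^sup>\<star> * x\<^sup>\<star>)" using finite_cstar_invertible[OF fin] by blast
  then obtain m' l where m': "norm (x\<^sup>\<star> - x\<^sup>\<star> * m') \<le> e / 2" "m' * l = 0" "cpos l" "l \<noteq> 0"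
    using half_gt_zero[OF e] by (rule near_zero_divisor)
  have "(x\<^sup>\<star> - x\<^sup>\<star> * m')\<^sup>\<star> = x - m'\<^sup>\<star> * x" by (simp add: star_simps)
  then have "norm (x - m'\<^sup>\<star> * x) \<le> e / 2" using m'(1) by (metis norm_star)
  then have "norm (a - m'\<^sup>\<star> * x) \<le> e"
    using norm_triangle_ineq[of "a - x" "x - m'\<^sup>\<star> * x"] m(1) by (simp add: x_def)
  moreover have "l * m'\<^sup>\<star> = 0" using arg_cong[OF m'(2), of star] cpos_star[OF m'(3)] by (simp add: star_mult)
  ultimately show ?thesis using that[of "m'\<^sup>\<star> * x" k l] m m' xk
    by (simp add: mult.assoc) (simp flip: mult.assoc)
qed

text \<open>The closed ideal \<open>I\<close> omits 1, hence is zero, and some \<open>s\<close> has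
  \<open>l * s * k \<noteq> 0\<close>. If \<open>l * k = 0\<close>, adding a large scalar makes
  \<open>s\<close> invertible without changing the product.\<close>

lemma simple_invertible_between:
  fixes k l :: "'a::unital_cstar_algebra"
  assumes simple: "simple_cstar TYPE('a)" and "k \<noteq> 0" "l \<noteq> 0"
  obtains t where "invertible_elt t" "l * t * k \<noteq> 0"
proof -
  define I where "I = {y. \<forall>t. l * t * y = 0}"
  have "a * x \<in> I" "x * a \<in> I" if "x \<in> I" for a x
  proof -
    have "l * t * (a * x) = l * (t * a) * x" "l * t * (x * a) = l * t * x * a" for t
      by (simp_all only: mult.assoc)
    then show "a * x \<in> I" "x * a \<in> I" using that by (simp_all add: I_def)
  qed
  moreover have "0 \<in> I" "\<And>x y. x \<in> I \<Longrightarrow> y \<in> I \<Longrightarrow> x + y \<in> I"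
      "\<And>c x. x \<in> I \<Longrightarrow> c *\<^sub>C x \<in> I"
    using scaleC_scaleR[of _ 0 "0::'a"] by (simp_all add: I_def distrib_left mult_scaleC_right)
  ultimately have "two_sided_ideal I" by (simp add: two_sided_ideal_def)
  moreover have "closed I"
  proof -
    have "I = (\<Inter>t. {y. l * t * y = 0})" by (auto simp: I_def)
    moreover have "closed {y. l * t * y = 0}" for t by (intro closed_Collect_eq continuous_intros)
    ultimately show ?thesis by auto
  qed
  ultimately have "I = {0} \<or> I = UNIV" using simple by (auto simp: simple_cstar_def)
  moreover have "1 \<notin> I" using assms(3) by (auto simp: I_def intro!: exI[of _ 1])
  ultimately have "k \<notin> I" using assms(2) by auto
  then obtain s where s: "l * s * k \<noteq> 0" by (auto simp: I_def)
  show ?thesis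
  proof (cases "l * k = 0")
    case False
    then show ?thesis using that[of 1] by simp
  next
    case True
    define r where "r = norm s + 1"
    have r: "0 < r" by (simp add: r_def add_nonneg_pos)
    have "norm (1 - (1 + s /\<^sub>R r)) < 1"
      using r by (simp add: r_def divide_less_eq flip: divide_inverse_commute)
    then have "invertible_elt (r *\<^sub>R (1 + s /\<^sub>R r))"
      using r by (intro invertible_elt_scaleR invertible_elt_near_1) simp_all
    then have "invertible_elt (r *\<^sub>R 1 + s)" using r by (simp add: scaleR_add_right)
    moreover have "l * (r *\<^sub>R 1 + s) * k \<noteq> 0" using s True by (simp add: distrib_left distrib_right)
    ultimately show ?thesis by (rule that)
  qed
qed

text \<open>For \<open>l k \<noteq> 0\<close> there is a nonzero \<open>j \<in> k A\<close> on which \<open>\<tau> l \<ge> 1\<close>, i.e. \<open>j\<^sup>\<star> (\<tau> l - 1) j \<ge> 0\<close>.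
  If \<open>\<phi> \<le> 1\<close> is supported on \<open>j j\<^sup>\<star>\<close>, then \<open>W = 1 + (\<tau> l - 1) \<phi>\<close> is invertible and maps the
  part of \<open>k A\<close> where \<open>\<phi> = 1\<close> into \<open>l A\<close>. So the self-adjoint elements of that part annihilate
  \<open>x\<close> from the right and \<open>W\<^sup>\<star> x\<close> from the left.\<close>

lemma rotate_annihilator:
  fixes x k l :: "'a::unital_cstar_algebra"
  assumes xk: "x * k = 0" and lx: "l * x = 0" and k: "cpos k" and l: "cpos l" and lk: "l * k \<noteq> 0"
  obtains U c c' where "invertible_elt U" "cpos c" "c \<noteq> 0" "c'\<^sup>\<star> = c'" "c' * c = c" "c * c' = c"
    "x * c' = 0" "c' * (U * x) = 0"
proof -
  have ks: "k\<^sup>\<star> = k" and ls: "l\<^sup>\<star> = l" using k l by (simp_all add: cpos_star)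
  obtain m where m: "m\<^sup>\<star> = m" "m * m = l" using cpos_sqrt[OF l] by metis
  define h where "h = k * l * k"
  have hm: "h = (m * k)\<^sup>\<star> * (m * k)"
    using m(1) ks by (simp add: h_def star_mult mult.assoc flip: m(2))
  have "m * k \<noteq> 0" using lk m(2) by (metis mult.assoc mult_zero_right)
  then have nh: "0 < norm h" unfolding hm cstar_identity by simp
  have hp: "cpos h" unfolding hm by (rule cpos_star_mult)
  \<comment> \<open>Half the norm, so that the part \<open>p\<close> of \<open>h\<close> above
    \<open>dl\<close> is nonzero.\<close>
  define dl where "dl = norm h / 2"
  have dl: "0 < dl" using nh by (simp add: dl_def)
  have "(h - dl *\<^sub>R 1)\<^sup>\<star> = h - dl *\<^sub>R 1" using hp by (simp add: star_simps cpos_star)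
  then obtain p n where p: "cpos p" and n: "cpos n" and pn: "h - dl *\<^sub>R 1 = p - n" "p * n = 0" "n * p = 0"
    by (rule cpos_parts) metis
  have ps: "p\<^sup>\<star> = p" by (rule cpos_star[OF p])
  have h: "h = dl *\<^sub>R 1 + p - n" using pn(1) by (simp add: algebra_simps)
  have p0: "p \<noteq> 0"
  proof
    assume "p = 0"
    then have "norm h \<le> norm (dl *\<^sub>R (1::'a))" using hp n h by (intro cpos_norm_le) simp_all
    then show False using nh by (simp add: dl_def)
  qed
  have php: "p * h * p = dl *\<^sub>R (p * p) + p * p * p"
  proof -
    have "p * h * p = dl *\<^sub>R (p * p) + p * p * p - (p * n) * p"
      unfolding h by (simp add: algebra_simps)
    then show ?thesis using pn(2) by simp
  qed
  have p3: "cpos (p * p * p)" by (rule cpos_conj_self_adjoint[OF p ps]) simp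
  have "k * p \<noteq> 0"
  proof
    assume "k * p = 0"
    then have "p * h * p = 0" by (simp add: h_def mult.assoc)
    then have "dl *\<^sub>R (p * p) = 0"
      using php dl cpos_add_eq_0[of "dl *\<^sub>R (p * p)" "p * p * p"] p3
      by (simp add: cpos_scaleR cpos_square ps)
    then have "p * p = 0" using dl by simp
    then show False using self_adjoint_square_eq_0[OF ps] p0 by simp
  qed
  \<comment> \<open>Normalised to give \<open>f\<close> norm 4: after two cuts at height 1 the
    remainder \<open>c\<close> is still nonzero.\<close>
  define gm where "gm = 2 / norm (k * p)"
  have gm: "0 < gm" using \<open>k * p \<noteq> 0\<close> by (simp add: gm_def)
  define j where "j = gm *\<^sub>R (k * p)"
  have js: "j\<^sup>\<star> = gm *\<^sub>R (p * k)" by (simp add: j_def star_simps ps ks)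
  have nj: "norm j = 2" using \<open>k * p \<noteq> 0\<close> by (simp add: j_def gm_def)
  \<comment> \<open>Since \<open>p * h * p\<close> dominates \<open>dl *\<^sub>R (p * p)\<close>,
    this factor makes \<open>tau *\<^sub>R (p * h * p)\<close> dominate
    \<open>p * (k * k) * p\<close>.\<close>
  define tau where "tau = (norm k)\<^sup>2 / dl"
  have tau: "0 \<le> tau" "tau * dl = (norm k)\<^sup>2" using dl by (simp_all add: tau_def)
  define N where "N = j\<^sup>\<star> * (tau *\<^sub>R l - 1) * j"
  have N: "cpos N"
  proof -
    have "p * (tau *\<^sub>R h - k * k) * p = tau *\<^sub>R (p * h * p) - p * (k * k) * p"
      by (simp add: algebra_simps)
    also have "\<dots> = p * ((norm k)\<^sup>2 *\<^sub>R 1 - k * k) * p + tau *\<^sub>R (p * p * p)"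
      unfolding php using tau(2) by (simp add: algebra_simps)
    also have "cpos \<dots>"
    proof (intro cpos_add cpos_scaleR p3 tau(1))
      have "cpos ((norm k)\<^sup>2 *\<^sub>R 1 - k * k)"
        by (intro cpos_one_minus) (simp_all add: star_mult ks norm_self_adjoint_square)
      then show "cpos (p * ((norm k)\<^sup>2 *\<^sub>R 1 - k * k) * p)" using cpos_conj[of _ p] by (simp add: ps)
    qed
    finally have "cpos ((gm * gm) *\<^sub>R (p * (tau *\<^sub>R h - k * k) * p))" by (intro cpos_scaleR) simp_all
    also have "(gm * gm) *\<^sub>R (p * (tau *\<^sub>R h - k * k) * p) = N"
      unfolding N_def js by (simp add: j_def h_def algebra_simps)
    finally show ?thesis .
  qed
  define f where "f = j * j\<^sup>\<star>"
  have fp: "cpos f" using cpos_star_mult[of "j\<^sup>\<star>"] by (simp add: f_def star_star)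
  have nf: "norm f = 4" using cstar_identity[of "j\<^sup>\<star>"] nj by (simp add: f_def star_star)
  \<comment> \<open>In terms of functional calculus, \<open>u\<close> is the part of
    \<open>f\<close> above 1 and \<open>1 - r\<close> is min(f, 1); below, \<open>c\<close> is the
    part of \<open>u\<close> above 1 and \<open>c'\<close> is min(u, 1).\<close>
  have "(f - 1)\<^sup>\<star> = f - 1" using fp by (simp add: star_simps cpos_star)
  then obtain u r where u: "cpos u" and r: "cpos r" and ur: "f - 1 = u - r" "u * r = 0" "r * u = 0"
    by (rule cpos_parts) metis
  obtain y where y: "(1 + u) * y = 1" "y * (1 + u) = 1" "cpos y"
    using cpos_add_scalar_inverse[OF u, of 1] by auto
  have f: "f = 1 + u - r" using ur(1) by (simp add: algebra_simps)
  have rf: "(1 - r) * (1 + u) = f" "(1 + u) * (1 - r) = f"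
    using ur by (simp_all add: f algebra_simps)
  have fy: "1 - r = f * y" "1 - r = y * f"
    using y unfolding rf(1)[symmetric] by (simp_all only: mult.assoc mult_1_right)
      (simp add: rf flip: rf(2) mult.assoc)
  define W where "W = 1 + (tau *\<^sub>R l - 1) * ((1 - r) * (1 - r))"
  \<comment> \<open>After swapping factors the claim concerns 1 plus a conjugate of the positive
    \<open>N\<close>.\<close>
  have "invertible_elt (1 + (1 - r) * ((tau *\<^sub>R l - 1) * (1 - r)))"
  proof -
    have "(1 - r) * ((tau *\<^sub>R l - 1) * (1 - r)) = (y * f) * ((tau *\<^sub>R l - 1) * (f * y))"
      by (simp only: fy(1)[symmetric] fy(2)[symmetric])
    also have "\<dots> = (j\<^sup>\<star> * y)\<^sup>\<star> * N * (j\<^sup>\<star> * y)"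
      unfolding f_def N_def by (simp add: star_simps cpos_star[OF y(3)] mult.assoc)
    finally show ?thesis using cpos_one_plus_invertible[OF cpos_conj[OF N]] by simp
  qed
  then have "invertible_elt (1 + ((tau *\<^sub>R l - 1) * (1 - r)) * (1 - r))"
    by (rule invertible_elt_one_plus_commute)
  then have W: "invertible_elt W" by (simp add: W_def mult.assoc)
  have "(u - 1)\<^sup>\<star> = u - 1" using u by (simp add: star_simps cpos_star)
  then obtain c d where c: "cpos c" and d: "cpos d" and cd: "u - 1 = c - d" "c * d = 0" "d * c = 0"
    by (rule cpos_parts) metis
  have rc: "r * c = 0"
  proof -
    \<comment> \<open>As \<open>r * u = 0\<close> and \<open>d * c = 0\<close>, both sides reduce,
      to \<open>- (r * c)\<close> and \<open>r * (c * c)\<close>; then \<open>1 + c\<close> can be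
      cancelled.\<close>
    have "r * (u - 1) * c = r * (c - d) * c" by (simp only: cd(1))
    then have rcc: "- (r * c) = r * (c * c)" using ur(3) cd(3) by (simp add: algebra_simps)
    have "r * c * (1 + c) = r * c + r * (c * c)" by (simp add: algebra_simps)
    then have "r * c * (1 + c) = 0" by (simp flip: rcc)
    moreover obtain z where "(1 + c) * z = 1"
      using cpos_one_plus_invertible[OF c] by (auto simp: invertible_elt_def)
    ultimately show ?thesis by (metis mult.assoc mult_1_right mult_zero_left)
  qed
  have c0: "c \<noteq> 0"
  proof
    assume "c = 0"
    then have "1 - u = d" using cd(1) by (simp add: algebra_simps)
    then have "norm u \<le> norm (1::'a)" using u d by (intro cpos_norm_le) simp_all
    moreover have "norm f \<le> norm (1 + u)" using fp r f by (intro cpos_norm_le) simp_all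
    ultimately show False using norm_triangle_ineq[of 1 u] nf by simp
  qed
  define c' where "c' = u - c"
  have c'd: "c' = 1 - d" using cd(1) by (simp add: c'_def algebra_simps)
  have c's: "c'\<^sup>\<star> = c'" using d by (simp add: c'd star_simps cpos_star)
  have rc': "(1 - r) * c' = c'" using ur(3) rc by (simp add: c'_def algebra_simps)
  have "W * c' = c' + (tau *\<^sub>R l - 1) * ((1 - r) * ((1 - r) * c'))" by (simp add: W_def distrib_right mult.assoc)
  then have Wc: "W * c' = tau *\<^sub>R (l * c')" unfolding rc' by (simp add: left_diff_distrib)
  have "c' * W\<^sup>\<star> = (W * c')\<^sup>\<star>" by (simp add: star_mult c's)
  then have "c' * W\<^sup>\<star> = tau *\<^sub>R (c' * l)" unfolding Wc by (simp add: star_simps c's ls)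
  then have "c' * (W\<^sup>\<star> * x) = tau *\<^sub>R (c' * l) * x" by (metis mult.assoc)
  then have "c' * (W\<^sup>\<star> * x) = 0" using lx by (simp add: mult.assoc)
  moreover have "x * c' = 0"
  proof -
    \<comment> \<open>\<open>c'\<close> lies in the right ideal generated by \<open>k\<close>,
      through \<open>c' = f * y * c'\<close>.\<close>
    have "x * c' = x * (f * y * c')" using rc' fy(1) by simp
    also have "\<dots> = gm *\<^sub>R ((x * k) * (p * (j\<^sup>\<star> * (y * c'))))"
      unfolding f_def by (subst j_def) (simp add: mult.assoc)
    finally show ?thesis by (simp add: xk)
  qed
  moreover have "c' * c = c" "c * c' = c" using cd by (simp_all add: c'd algebra_simps)
  ultimately show ?thesis using that[of "W\<^sup>\<star>" c c'] W c c0 c's invertible_elt_star by blast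
qed

text \<open>Multiplying \<open>x\<close> by \<open>V\<close>, the inverse of \<open>t\<close>, moves
  its right annihilator to \<open>t * k * t\<^sup>\<star>\<close>, whose product with
  \<open>l\<close> is nonzero, as \<open>rotate_annihilator\<close> requires.\<close>

lemma finite_simple_near_zero_divisor:
  fixes a :: "'a::unital_cstar_algebra"
  assumes fin: "finite_cstar TYPE('a)" and simple: "simple_cstar TYPE('a)"
    and inv: "\<not> invertible_elt a" and e: "0 < e"
  obtains x U V c c' where "norm (a - x) \<le> e" "invertible_elt U" "invertible_elt V"
    "cpos c" "c \<noteq> 0" "c'\<^sup>\<star> = c'" "c' * c = c" "c * c' = c"
    "(U * x * V) * c' = 0" "c' * (U * x * V) = 0"
proof -
  obtain x k l where x: "norm (a - x) \<le> e" "x * k = 0" "l * x = 0"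
    and k: "cpos k" "k \<noteq> 0" and l: "cpos l" "l \<noteq> 0"
    using finite_near_two_sided_zero_divisor[OF fin inv e] by metis
  obtain t where t: "invertible_elt t" "l * t * k \<noteq> 0"
    using simple_invertible_between[OF simple k(2) l(2)] by metis
  obtain V where V: "t * V = 1" "V * t = 1" using t by (auto simp: invertible_elt_def)
  obtain w where w: "t\<^sup>\<star> * w = 1" "w * t\<^sup>\<star> = 1"
    using invertible_elt_star[OF t(1)] by (auto simp: invertible_elt_def)
  have "x * V * (t * k * t\<^sup>\<star>) = (x * (V * t) * k) * t\<^sup>\<star>" by (simp only: mult.assoc)
  then have 1: "x * V * (t * k * t\<^sup>\<star>) = 0" using V x by simp
  have 2: "l * (x * V) = 0" using x by (simp flip: mult.assoc)
  have 3: "cpos (t * k * t\<^sup>\<star>)" using cpos_conj[OF k(1), of "t\<^sup>\<star>"] by (simp add: star_star)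
  have 4: "l * (t * k * t\<^sup>\<star>) \<noteq> 0"
  proof
    assume "l * (t * k * t\<^sup>\<star>) = 0"
    then have "l * (t * k * t\<^sup>\<star>) * w = 0" by simp
    moreover have "l * (t * k * t\<^sup>\<star>) * w = l * t * k * (t\<^sup>\<star> * w)" by (simp only: mult.assoc)
    ultimately show False using w t by simp
  qed
  obtain U c c' where U: "invertible_elt U" "cpos c" "c \<noteq> 0" "c'\<^sup>\<star> = c'" "c' * c = c" "c * c' = c"
    "x * V * c' = 0" "c' * (U * (x * V)) = 0"
    using rotate_annihilator[OF 1 2 3 l(1) 4] by metis
  have "invertible_elt V" using V(2,1) by (rule invertible_eltI)
  then show ?thesis using that[of x U V c c'] x(1) U by (simp add: mult.assoc)
qed

section \<open>Constant sequences and lifting\<close>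

lemma const_ainf_simps:
  "const_ainf (a + b) = const_ainf a + const_ainf b"
  "const_ainf (a - b) = const_ainf a - const_ainf b"
  "const_ainf (a * b) = const_ainf a * const_ainf b"
  "const_ainf (r *\<^sub>R a) = r *\<^sub>R const_ainf a"
  "const_ainf (c *\<^sub>C a) = c *\<^sub>C const_ainf a"
  "const_ainf (a\<^sup>\<star>) = (const_ainf a)\<^sup>\<star>"
  "const_ainf 0 = 0"
  for a b :: "'a::cstar_algebra"
  by (simp_all add: const_ainf_def Ainf_ops Ainf_scaleC Ainf_star Ainf_zero)

lemma const_ainf_1: "const_ainf (1::'a::unital_cstar_algebra) = 1"
  by (simp add: one_ainf_def)

lemma norm_const_ainf_le: "norm (const_ainf a) \<le> norm a"
  unfolding const_ainf_def by (rule norm_Ainf_le) simp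

lemma bounded_linear_const_ainf: "bounded_linear (const_ainf :: 'a::cstar_algebra \<Rightarrow> 'a ainf)"
  by (rule bounded_linear_intro[of _ 1]) (simp_all add: const_ainf_simps norm_const_ainf_le)

lemma const_ainf_eq_0_iff: "const_ainf a = 0 \<longleftrightarrow> a = 0"
  by (simp add: const_ainf_def Ainf_zero Ainf_eq_iff c_zero_iff LIMSEQ_const_iff)

lemma const_ainf_in_pospos:
  assumes "cpos c" "c \<noteq> 0"
  shows "const_ainf c \<in> ainf_pospos"
proof -
  obtain s where s: "s\<^sup>\<star> = s" "s * s = c" using cpos_sqrt[OF assms(1)] by metis
  have "cpos (const_ainf s * const_ainf s)"
    by (rule cpos_square) (simp add: s flip: const_ainf_simps)
  then have "const_ainf c \<in> positive_elts"
    using s by (simp add: cpos_imp_positive_elts flip: const_ainf_simps)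
  then show ?thesis
    using assms(2) unfolding ainf_pospos_def
    by (auto intro!: bexI[of _ "\<lambda>n. c"] simp: const_ainf_def LIMSEQ_const_iff)
qed

text \<open>Annihilation is a closed condition and holds on the elements
  \<open>z * y * z\<close>.\<close>

lemma hereditary_subalgebra_annihilated:
  assumes p: "p \<in> hereditary_subalgebra z"
  shows "r * z = 0 \<Longrightarrow> r * p = 0" and "z * r = 0 \<Longrightarrow> p * r = 0"
proof -
  assume r: "r * z = 0"
  have "closed {p. r * p = 0}" by (intro closed_Collect_eq continuous_intros)
  moreover have "{z * y * z |y. True} \<subseteq> {p. r * p = 0}" using r by (auto simp flip: mult.assoc)
  ultimately show "r * p = 0" using p closure_minimal unfolding hereditary_subalgebra_def by blast
next
  assume r: "z * r = 0"
  have "closed {p. p * r = 0}" by (intro closed_Collect_eq continuous_intros)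
  moreover have "{z * y * z |y. True} \<subseteq> {p. p * r = 0}" using r by (auto simp: mult.assoc)
  ultimately show "p * r = 0" using p closure_minimal unfolding hereditary_subalgebra_def by blast
qed

section \<open>Lifting invertible elements from the sequence algebra\<close>

lemma Ainf_inverse_eventually:
  fixes X Y :: "nat \<Rightarrow> 'a::unital_cstar_algebra"
  assumes "X \<in> l_infty" "Y \<in> l_infty" "Ainf X * Ainf Y = 1"
  shows "\<forall>\<^sub>F n in sequentially. invertible_elt (X n * Y n)"
proof -
  have "(\<lambda>n. 1 - X n * Y n) \<in> l_infty" using assms by (auto intro!: l_infty_intros)
  moreover have eq: "Ainf (\<lambda>n. 1 - X n * Y n) = 1 - Ainf X * Ainf Y"
    using assms(1,2) by (simp add: one_ainf_def const_ainf_def Ainf_ops l_infty_mult)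
  have "norm (Ainf (\<lambda>n. 1 - X n * Y n)) < 1" unfolding eq assms(3) by simp
  ultimately have "\<forall>\<^sub>F n in sequentially. norm (1 - X n * Y n) < 1" by (rule norm_Ainf_ev)
  then show ?thesis by (rule eventually_mono) (rule invertible_elt_near_1)
qed

text \<open>Both products of representatives of \<open>K\<close> and its inverse are eventually
  invertible, so late terms have left and right inverses.\<close>

lemma invertible_ainf_lift:
  fixes x :: "'a::unital_cstar_algebra"
  assumes K: "invertible_elt K" "norm (K - const_ainf x) < e"
  obtains y where "invertible_elt y" "norm (y - x) < e"
proof -
  obtain M where M: "K * M = 1" "M * K = 1" using K by (auto simp: invertible_elt_def)
  obtain X where X: "X \<in> l_infty" "K = Ainf X" by (rule Ainf_cases)
  obtain Y where Y: "Y \<in> l_infty" "M = Ainf Y" by (rule Ainf_cases)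
  have "norm (Ainf (\<lambda>n. X n - x)) < e"
    using K(2) X by (simp add: const_ainf_def Ainf_diff)
  then have "\<forall>\<^sub>F n in sequentially. norm (X n - x) < e"
    using X by (intro norm_Ainf_ev) (auto intro!: l_infty_intros)
  moreover have "\<forall>\<^sub>F n in sequentially. invertible_elt (X n * Y n)"
    using Ainf_inverse_eventually[OF X(1) Y(1)] M X Y by simp
  moreover have "\<forall>\<^sub>F n in sequentially. invertible_elt (Y n * X n)"
    using Ainf_inverse_eventually[OF Y(1) X(1)] M X Y by simp
  ultimately have "\<forall>\<^sub>F n in sequentially. norm (X n - x) < e \<and> invertible_elt (X n * Y n) \<and> invertible_elt (Y n * X n)"
    by (intro eventually_conj)
  then obtain n where n: "norm (X n - x) < e" "invertible_elt (X n * Y n)" "invertible_elt (Y n * X n)"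
    by (auto simp: eventually_sequentially)
  obtain a b where "X n * Y n * a = 1" "b * (Y n * X n) = 1" using n by (auto simp: invertible_elt_def)
  then have "invertible_elt (X n)" by (metis invertible_eltI mult.assoc)
  then show ?thesis using that n by blast
qed

section \<open>Tracially split homomorphisms\<close>

lemma tracially_sequentially_splitE:
  fixes \<phi> :: "'a::unital_cstar_algebra \<Rightarrow> 'b::unital_cstar_algebra"
  assumes "tracially_sequentially_split \<phi>" "\<phi> 1 = 1" "cpos c" "c \<noteq> 0"
  obtains \<psi> g p v where "star_hom \<psi>" "is_projection g" "g \<noteq> 0" "\<And>a. g * const_ainf a = const_ainf a * g"
    "\<And>a. \<psi> (\<phi> a) = const_ainf a * g" "\<psi> 1 = g" "p \<in> hereditary_subalgebra (const_ainf c)"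
    "v\<^sup>\<star> * v = 1 - g" "v * v\<^sup>\<star> = p"
proof -
  have z: "const_ainf c \<in> ainf_pospos \<and> const_ainf c \<noteq> 0"
    using assms const_ainf_in_pospos by (simp add: const_ainf_eq_0_iff)
  from assms(1) have "\<forall>z :: 'a ainf. z \<in> ainf_pospos \<and> z \<noteq> 0 \<longrightarrow>
       (\<exists>(\<psi> :: 'b \<Rightarrow> 'a ainf) g.
          star_hom \<psi> \<and> is_projection g \<and> g \<noteq> 0 \<and> g \<in> central_seq_algebra \<and>
          (\<forall>a. \<psi> (\<phi> a) = const_ainf a * g) \<and>
          (\<exists>p. is_projection p \<and> p \<in> hereditary_subalgebra z \<and> mvn_equiv (1 - g) p))"
    unfolding tracially_sequentially_split_def by (rule conjunct2)
  from this[rule_format, OF z] obtain \<psi> :: "'b \<Rightarrow> 'a ainf" and g p where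
    *: "star_hom \<psi>" "is_projection g" "g \<noteq> 0" "g \<in> central_seq_algebra"
    "\<And>a. \<psi> (\<phi> a) = const_ainf a * g" "p \<in> hereditary_subalgebra (const_ainf c)" "mvn_equiv (1 - g) p"
    by blast
  obtain v where "v\<^sup>\<star> * v = 1 - g" "v * v\<^sup>\<star> = p" using *(7) by (auto simp: mvn_equiv_def)
  moreover have "\<psi> 1 = g" using *(5)[of 1] assms(2) by (simp add: const_ainf_1)
  ultimately show ?thesis using that * by (simp add: central_seq_algebra_def)
qed

lemma tracially_split_finite:
  fixes \<phi> :: "'a::unital_cstar_algebra \<Rightarrow> 'b::unital_cstar_algebra"
  assumes split: "tracially_sequentially_split \<phi>" "\<phi> 1 = 1"
    and simple: "simple_cstar TYPE('a)" and fin: "finite_cstar TYPE('b)"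
  shows "finite_cstar TYPE('a)"
  unfolding finite_cstar_def
proof (intro allI impI)
  fix v :: 'a assume v: "v\<^sup>\<star> * v = 1"
  have hom: "\<phi> (x * y) = \<phi> x * \<phi> y" "\<phi> (x\<^sup>\<star>) = (\<phi> x)\<^sup>\<star>" for x y
    using split(1) by (simp_all add: tracially_sequentially_split_def star_hom_def)
  \<comment> \<open>Any admissible element yields a nonzero \<open>g\<close>; the constant 1 is
    taken.\<close>
  obtain \<psi> :: "'b \<Rightarrow> 'a ainf" and g p w :: "'a ainf" where g: "g \<noteq> 0" "\<And>a. g * const_ainf a = const_ainf a * g"
    and \<psi>: "\<And>a. \<psi> (\<phi> a) = const_ainf a * g" "\<psi> 1 = g"
    by (rule tracially_sequentially_splitE[OF split cpos_1]) auto
  \<comment> \<open>The kernel of multiplication by \<open>g\<close>, two-sided because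
    \<open>g\<close> commutes with constants.\<close>
  define I where "I = {x. const_ainf x * g = 0}"
  have "a * x \<in> I" "x * a \<in> I" if "x \<in> I" for a x
  proof -
    have "const_ainf (x * a) * g = const_ainf x * g * const_ainf a"
      by (simp add: const_ainf_simps g(2) mult.assoc)
    then show "x * a \<in> I" using that by (simp add: I_def)
    show "a * x \<in> I" using that by (simp add: I_def const_ainf_simps mult.assoc)
  qed
  moreover have "0 \<in> I" "\<And>x y. x \<in> I \<Longrightarrow> y \<in> I \<Longrightarrow> x + y \<in> I"
      "\<And>c x. x \<in> I \<Longrightarrow> c *\<^sub>C x \<in> I"
    using scaleC_scaleR[of _ 0 "0::'a ainf"]
    by (simp_all add: I_def const_ainf_simps distrib_right mult_scaleC_left)
  ultimately have "two_sided_ideal I" by (simp add: two_sided_ideal_def)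
  moreover have "closed I" unfolding I_def
    by (intro closed_Collect_eq continuous_intros bounded_linear.continuous_on[OF bounded_linear_const_ainf])
  ultimately have "I = {0} \<or> I = UNIV" using simple by (auto simp: simple_cstar_def)
  moreover have "1 \<notin> I" using g(1) by (simp add: I_def const_ainf_1)
  ultimately have I: "I = {0}" by auto
  have "(\<phi> v)\<^sup>\<star> * \<phi> v = 1" using v split(2) by (simp flip: hom)
  then have "\<phi> v * (\<phi> v)\<^sup>\<star> = 1" using fin by (simp add: finite_cstar_def)
  then have "\<phi> (v * v\<^sup>\<star>) = 1" by (simp add: hom)
  then have "const_ainf (v * v\<^sup>\<star>) * g = g" using \<psi> by metis
  then have "1 - v * v\<^sup>\<star> \<in> I" by (simp add: I_def const_ainf_simps const_ainf_1 left_diff_distrib)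
  then show "v * v\<^sup>\<star> = 1" by (simp add: I)
qed

text \<open>Write \<open>e = 1 - g\<close>, \<open>r = 1 - c'\<close> and \<open>w = v r\<close>. The element \<open>D = (X + \<kappa> r\<^sup>2 + \<lambda>) e + \<psi> y\<close> is
  invertible and acts as \<open>\<lambda>\<close> on the range of \<open>w\<close>, whence
  \<open>(1 - \<alpha> w\<^sup>\<star>) D (1 + \<alpha> w) = D + \<alpha> \<lambda> (w - w\<^sup>\<star>) - \<alpha>\<^sup>2 \<lambda> w\<^sup>\<star> w\<close>. As \<open>w\<^sup>\<star> w = r\<^sup>2 e\<close>, the choice
  \<open>\<alpha>\<^sup>2 \<lambda> = \<kappa>\<close> cancels the large term \<open>\<kappa> r\<^sup>2 e\<close>, and \<open>\<alpha> \<lambda>\<close> tends to \<open>0\<close> with \<open>\<lambda>\<close>.\<close>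

lemma tracially_split_near_invertible:
  fixes \<phi> :: "'a::unital_cstar_algebra \<Rightarrow> 'b::unital_cstar_algebra" and X :: 'a
  assumes split: "tracially_sequentially_split \<phi>" "\<phi> 1 = 1"
    and sr: "stable_rank_one TYPE('b)"
    and c: "cpos c" "c \<noteq> 0" and c': "c'\<^sup>\<star> = c'" "c' * c = c" "c * c' = c"
    and X: "X * c' = 0" "c' * X = 0" and e: "0 < e"
  obtains y where "invertible_elt y" "norm (y - X) < e"
proof -
  let ?C = "const_ainf :: 'a \<Rightarrow> 'a ainf"
  have phi: "\<phi> (x * y) = \<phi> x * \<phi> y" "\<phi> (x + y) = \<phi> x + \<phi> y" for x y
    using split(1) by (simp_all add: tracially_sequentially_split_def star_hom_def)
  have phi0: "\<phi> 0 = 0" using phi(2)[of 0 0] by simp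
  obtain \<psi> g p v where hom: "star_hom \<psi>" and g: "is_projection g" "\<And>a. g * ?C a = ?C a * g"
    and psi: "\<And>a. \<psi> (\<phi> a) = ?C a * g" "\<psi> 1 = g" and p: "p \<in> hereditary_subalgebra (?C c)"
    and v: "v\<^sup>\<star> * v = 1 - g" "v * v\<^sup>\<star> = p"
    using tracially_sequentially_splitE[OF split c] by metis
  have psih: "\<psi> (x + y) = \<psi> x + \<psi> y" "\<psi> (x * y) = \<psi> x * \<psi> y" "\<psi> (k *\<^sub>R x) = k *\<^sub>R \<psi> x" for x y k
    using hom by (simp_all add: star_hom_def scaleR_scaleC)
  have psid: "\<psi> (x - y) = \<psi> x - \<psi> y" for x y using psih(1)[of "x - y" y] by simp
  have psig: "g * \<psi> x = \<psi> x" "\<psi> x * g = \<psi> x" for x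
    unfolding psi(2)[symmetric] by (simp_all flip: psih(2))
  have gg: "g * g = g" "g\<^sup>\<star> = g" using g by (simp_all add: is_projection_def)
  define r where "r = 1 - c'"
  have rs: "r\<^sup>\<star> = r" using c' by (simp add: r_def star_simps)
  have rc: "r * c = 0" "c * r = 0" using c' by (simp_all add: r_def algebra_simps)
  have rX: "r * X = X" using X by (simp add: r_def algebra_simps)
  have Xc: "X * c = 0" "c * X = 0"
  proof -
    have "X * c = X * c' * c" "c * X = c * (c' * X)" using c' by (simp_all add: mult.assoc) (simp flip: mult.assoc)
    then show "X * c = 0" "c * X = 0" using X by simp_all
  qed
  define kap where "kap = norm X + 1"
  have kap: "1 \<le> kap" "norm X < kap" by (simp_all add: kap_def)
  \<comment> \<open>Sized so that \<open>lam + 2 * eta * norm r \<le> e / 3\<close>, while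
    \<open>y\<close> contributes less than \<open>e / 3\<close>.\<close>
  define eta where "eta = min 1 (e / (6 * (norm r + 1)))"
  have nr: "0 < norm r + 1" by (simp add: add_nonneg_pos)
  have eta0: "0 < eta" "eta \<le> 1" using e nr by (simp_all add: eta_def)
  have "eta \<le> e / (6 * (norm r + 1))" by (simp add: eta_def)
  then have "eta * (6 * (norm r + 1)) \<le> e" using nr by (subst (asm) pos_le_divide_eq) simp_all
  note eta = eta0 this
  \<comment> \<open>\<open>lam\<close> and \<open>alp\<close> solve \<open>alp * lam = eta\<close>
    and \<open>alp * alp * lam = kap\<close>.\<close>
  define lam where "lam = eta\<^sup>2 / kap"
  define alp where "alp = kap / eta"
  have lam: "0 < lam" using eta kap by (simp add: lam_def)
  have al: "alp * lam = eta" "alp * (alp * lam) = kap"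
    using eta kap by (simp_all add: alp_def lam_def power2_eq_square)
  have lam_le: "lam \<le> eta"
  proof -
    have "eta\<^sup>2 \<le> eta * 1" unfolding power2_eq_square using eta by (intro mult_left_mono) simp_all
    also have "\<dots> \<le> eta * kap" using eta kap by (intro mult_left_mono) simp_all
    finally show ?thesis using kap by (simp add: lam_def divide_le_eq)
  qed
  obtain y where y: "invertible_elt y" "norm (y - (\<phi> X + lam *\<^sub>R 1)) < e / 3"
    "y * \<phi> c = lam *\<^sub>R \<phi> c" "\<phi> c * y = lam *\<^sub>R \<phi> c"
  proof (rule stable_rank_one_scalar_corner[OF sr, of "\<phi> X" "\<phi> c'" "\<phi> c" lam "e / 3"])
    show "\<phi> X * \<phi> c' = 0" "\<phi> c' * \<phi> X = 0" "\<phi> c' * \<phi> c = \<phi> c" "\<phi> c * \<phi> c' = \<phi> c"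
      using X c' phi0 by (simp_all flip: phi(1))
  qed (use lam e in auto)
  obtain y' where y': "y * y' = 1" "y' * y = 1" using y(1) by (auto simp: invertible_elt_def)
  define D0 where "D0 = X + kap *\<^sub>R (r * r) + lam *\<^sub>R 1"
  \<comment> \<open>As \<open>r * X = X\<close>, \<open>D0\<close> factors through
    \<open>1 + X /\<^sub>R (kap + lam)\<close>, which is invertible because
    \<open>kap > norm X\<close>.\<close>
  have "invertible_elt D0"
  proof -
    have "kap * norm (X /\<^sub>R (kap + lam)) < kap * 1"
      using kap lam by (intro mult_strict_left_mono) (simp_all add: divide_less_eq flip: divide_inverse_commute)
    then have "invertible_elt (1 + X /\<^sub>R (kap + lam))"
      using kap by (intro invertible_elt_near_1) simp
    moreover have "invertible_elt (lam *\<^sub>R 1 + kap *\<^sub>R (r * r))"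
      using lam kap rs by (intro cpos_add_scalar_invertible cpos_scaleR cpos_square) simp_all
    ultimately have "invertible_elt ((lam *\<^sub>R 1 + kap *\<^sub>R (r * r)) * (1 + X /\<^sub>R (kap + lam)))"
      by (intro invertible_elt_mult)
    also have "(lam *\<^sub>R 1 + kap *\<^sub>R (r * r)) * (1 + X /\<^sub>R (kap + lam)) = D0"
    proof -
      have "(lam *\<^sub>R 1 + kap *\<^sub>R (r * r)) * X = (kap + lam) *\<^sub>R X"
        by (simp add: distrib_right mult.assoc rX scaleR_add_left add.commute)
      then have "(lam *\<^sub>R 1 + kap *\<^sub>R (r * r)) * (X /\<^sub>R (kap + lam)) = X"
        using kap lam by simp
      then show ?thesis unfolding distrib_left by (simp add: D0_def)
    qed
    finally show ?thesis .
  qed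
  then obtain D0' where D0': "D0 * D0' = 1" "D0' * D0 = 1" by (auto simp: invertible_elt_def)
  have D0c: "D0 * c = lam *\<^sub>R c" "c * D0 = lam *\<^sub>R c"
  proof -
    have "r * r * c = 0" "c * (r * r) = 0" using rc by (simp add: mult.assoc, simp flip: mult.assoc)
    then show "D0 * c = lam *\<^sub>R c" "c * D0 = lam *\<^sub>R c"
      using Xc by (simp_all add: D0_def distrib_left distrib_right)
  qed
  define E where "E = 1 - g"
  have EE: "E * E = E" "E\<^sup>\<star> = E" "E * g = 0" "g * E = 0"
    using gg by (simp_all add: E_def star_simps algebra_simps)
  have Eg: "E + g = 1" by (simp add: E_def)
  have EC: "E * ?C a = ?C a * E" for a using g(2)[of a] by (simp add: E_def algebra_simps)
  define D where "D = ?C D0 * E + \<psi> y"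
  \<comment> \<open>The corners of \<open>E\<close> and \<open>g\<close> are orthogonal, so pairs
    multiply componentwise.\<close>
  have split_mult: "(?C a * E + \<psi> b) * (?C a' * E + \<psi> b') = ?C (a * a') * E + \<psi> (b * b')" for a a' b b'
  proof -
    have "(?C a * E) * (?C a' * E) = ?C (a * a') * E"
    proof -
      have "(?C a * E) * (?C a' * E) = ?C a * (E * ?C a') * E" by (simp only: mult.assoc)
      then show ?thesis unfolding EC by (simp add: mult.assoc EE const_ainf_simps)
    qed
    moreover have "(?C a * E) * \<psi> b' = 0"
    proof -
      have "(?C a * E) * \<psi> b' = ?C a * (E * g) * \<psi> b'" by (simp add: mult.assoc psig)
      then show ?thesis by (simp add: EE)
    qed
    moreover have "\<psi> b * (?C a' * E) = 0"
    proof -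
      have "\<psi> b * (?C a' * E) = (\<psi> b * g) * (E * ?C a')" by (simp only: psig EC)
      also have "\<dots> = \<psi> b * (g * E) * ?C a'" by (simp only: mult.assoc)
      finally show ?thesis by (simp add: EE)
    qed
    ultimately show ?thesis by (simp add: distrib_left distrib_right psih)
  qed
  have "?C 1 * E + \<psi> 1 = 1" by (simp add: const_ainf_1 psi Eg)
  then have Dinv: "invertible_elt D"
    unfolding D_def using split_mult[of D0 y D0' y'] split_mult[of D0' y' D0 y]
    by (intro invertible_eltI[of _ "?C D0' * E + \<psi> y'" "?C D0' * E + \<psi> y'"]) (simp_all add: D0' y')
  \<comment> \<open>The constant \<open>c\<close> corresponds to the pair of \<open>c\<close> and
    \<open>\<phi> c\<close>, on both of which \<open>D\<close> acts as \<open>lam\<close>.\<close>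
  have Cc: "?C c = ?C c * E + \<psi> (\<phi> c)" by (simp add: psi Eg flip: distrib_left)
  have DC: "D * ?C c = lam *\<^sub>R ?C c" "?C c * D = lam *\<^sub>R ?C c"
  proof -
    have "?C (lam *\<^sub>R c) * E + \<psi> (lam *\<^sub>R \<phi> c) = lam *\<^sub>R (?C c * E + \<psi> (\<phi> c))"
      by (simp add: const_ainf_simps psih scaleR_add_right)
    then have *: "?C (lam *\<^sub>R c) * E + \<psi> (lam *\<^sub>R \<phi> c) = lam *\<^sub>R ?C c" using Cc by metis
    show "D * ?C c = lam *\<^sub>R ?C c"
      by (subst Cc) (simp only: D_def split_mult D0c y *)
    show "?C c * D = lam *\<^sub>R ?C c"
      by (subst Cc) (simp only: D_def split_mult D0c y *)
  qed
  \<comment> \<open>These relations pass from \<open>c\<close> to its hereditary subalgebra, hence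
    to \<open>p\<close>.\<close>
  have "(D - lam *\<^sub>R 1) * p = 0"
    by (rule hereditary_subalgebra_annihilated(1)[OF p]) (simp add: left_diff_distrib DC)
  then have Dp: "D * p = lam *\<^sub>R p" by (simp add: left_diff_distrib)
  have "p * (D - lam *\<^sub>R 1) = 0"
    by (rule hereditary_subalgebra_annihilated(2)[OF p]) (simp add: right_diff_distrib DC)
  then have pD: "p * D = lam *\<^sub>R p" by (simp add: right_diff_distrib)
  have Rp: "?C r * p = 0"
    by (rule hereditary_subalgebra_annihilated(1)[OF p]) (simp add: rc flip: const_ainf_simps)
  have ps: "p\<^sup>\<star> = p" using v(2) by (auto simp: star_simps)
  have "v - v * E = 0"
  proof -
    have "(v - v * E)\<^sup>\<star> * (v - v * E) = v\<^sup>\<star> * v - v\<^sup>\<star> * v * E - E * (v\<^sup>\<star> * v) + E * (v\<^sup>\<star> * v) * E"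
      by (simp add: star_simps EE algebra_simps)
    also have "\<dots> = 0" using v(1) EE by (simp flip: E_def)
    finally have "(norm (v - v * E))\<^sup>2 = 0" by (simp flip: cstar_identity)
    then show ?thesis by simp
  qed
  moreover have "p * v = v * E" using v by (simp add: E_def mult.assoc flip: v(2))
  ultimately have pv: "p * v = v" by simp
  define w where "w = v * ?C r"
  have pw: "p * w = w" by (simp add: w_def pv flip: mult.assoc)
  then have wp: "w\<^sup>\<star> * p = w\<^sup>\<star>" using ps by (metis star_mult)
  have Dw: "D * w = lam *\<^sub>R w" using Dp pw by (metis mult.assoc mult_scaleR_left)
  have wD: "w\<^sup>\<star> * D = lam *\<^sub>R w\<^sup>\<star>" using pD wp by (metis mult.assoc mult_scaleR_right)
  \<comment> \<open>\<open>w\<close> begins with \<open>p\<close> and ends with \<open>r\<close>,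
    and \<open>r\<close> annihilates \<open>p\<close>. Nilpotency makes the outer factors of
    \<open>K\<close> invertible.\<close>
  have "w * w = v * (?C r * p) * w" using pw by (metis w_def mult.assoc)
  then have ww: "w * w = 0" using Rp by simp
  then have sww: "w\<^sup>\<star> * w\<^sup>\<star> = 0" by (metis star_mult star_zero)
  have CrE: "w\<^sup>\<star> * w = ?C (r * r) * E"
  proof -
    have "w\<^sup>\<star> * w = ?C r * (v\<^sup>\<star> * v) * ?C r"
      by (simp add: w_def star_mult mult.assoc rs flip: const_ainf_simps(6))
    also have "\<dots> = ?C r * (E * ?C r)" using v(1) by (simp add: E_def mult.assoc)
    finally show ?thesis unfolding EC by (simp add: const_ainf_simps mult.assoc)
  qed
  define K where "K = (1 - alp *\<^sub>R w\<^sup>\<star>) * D * (1 + alp *\<^sub>R w)"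
  have Kinv: "invertible_elt K"
    unfolding K_def
  proof (intro invertible_elt_mult Dinv)
    show "invertible_elt (1 - alp *\<^sub>R w\<^sup>\<star>)"
      by (rule invertible_eltI[of _ "1 + alp *\<^sub>R w\<^sup>\<star>" "1 + alp *\<^sub>R w\<^sup>\<star>"]) (simp_all add: algebra_simps sww)
    show "invertible_elt (1 + alp *\<^sub>R w)"
      by (rule invertible_eltI[of _ "1 - alp *\<^sub>R w" "1 - alp *\<^sub>R w"]) (simp_all add: algebra_simps ww)
  qed
  have "K = D + alp *\<^sub>R (D * w) - alp *\<^sub>R (w\<^sup>\<star> * D) - (alp * alp) *\<^sub>R (w\<^sup>\<star> * (D * w))"
    by (simp add: K_def algebra_simps)
  also have "\<dots> = D + (alp * lam) *\<^sub>R (w - w\<^sup>\<star>) - (alp * (alp * lam)) *\<^sub>R (w\<^sup>\<star> * w)"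
    unfolding Dw wD by (simp add: algebra_simps)
  \<comment> \<open>The subtracted term cancels the \<open>kap\<close> summand of
    \<open>D0\<close>.\<close>
  finally have "K = D + eta *\<^sub>R (w - w\<^sup>\<star>) - kap *\<^sub>R (?C (r * r) * E)"
    unfolding al(2) unfolding al(1) CrE .
  also have "\<dots> = ?C X * E + lam *\<^sub>R E + \<psi> y + eta *\<^sub>R (w - w\<^sup>\<star>)"
    by (simp add: D_def D0_def const_ainf_simps const_ainf_1 distrib_right)
  \<comment> \<open>\<open>\<psi> (\<phi> X)\<close> is \<open>X\<close> cut down by
    \<open>g\<close>, so the two corners recombine to \<open>X\<close>.\<close>
  also have "\<dots> = ?C X * (E + g) + lam *\<^sub>R (E + g) + \<psi> (y - (\<phi> X + lam *\<^sub>R 1)) + eta *\<^sub>R (w - w\<^sup>\<star>)"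
    by (simp add: psid psih psi distrib_left scaleR_add_right)
  finally have K: "K - ?C X = lam *\<^sub>R 1 + \<psi> (y - (\<phi> X + lam *\<^sub>R 1)) + eta *\<^sub>R (w - w\<^sup>\<star>)"
    by (simp add: Eg)
  have "norm v \<le> 1"
  proof -
    have "(norm v)\<^sup>2 = norm E" using v(1) by (simp add: E_def flip: cstar_identity)
    also have "\<dots> \<le> 1" using EE by (intro norm_projection_le_1) (simp add: is_projection_def)
    finally show ?thesis by (simp add: abs_square_le_1)
  qed
  then have nw: "norm w \<le> norm r"
    using norm_mult_ineq[of v "?C r"] mult_mono[of "norm v" 1 "norm (?C r)" "norm r"] norm_const_ainf_le[of r]
    by (simp add: w_def)
  have "norm (K - ?C X) \<le> norm (lam *\<^sub>R (1::'a ainf)) + norm (\<psi> (y - (\<phi> X + lam *\<^sub>R 1))) + norm (eta *\<^sub>R (w - w\<^sup>\<star>))"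
    unfolding K by (intro norm_triangle_le add_mono order_refl norm_triangle_ineq)
  also have "\<dots> \<le> lam + norm (y - (\<phi> X + lam *\<^sub>R 1)) + eta * (2 * norm r)"
  proof (intro add_mono)
    show "norm (\<psi> (y - (\<phi> X + lam *\<^sub>R 1))) \<le> norm (y - (\<phi> X + lam *\<^sub>R 1))"
      by (rule norm_star_hom_le[OF hom])
    show "norm (eta *\<^sub>R (w - w\<^sup>\<star>)) \<le> eta * (2 * norm r)"
      using eta nw norm_triangle_ineq4[of w "w\<^sup>\<star>"] by (simp add: mult_left_mono)
  qed (use lam in simp)
  also have "\<dots> < e"
    using y(2) lam_le eta e by (simp add: algebra_simps)
  finally show ?thesis using invertible_ainf_lift[OF Kinv] that by blast
qed

lemma tracially_split_stable_rank_one: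
  fixes \<phi> :: "'a::unital_cstar_algebra \<Rightarrow> 'b::unital_cstar_algebra"
  assumes split: "tracially_sequentially_split \<phi>" "\<phi> 1 = 1"
    and simple: "simple_cstar TYPE('a)" and sr: "stable_rank_one TYPE('b)"
  shows "stable_rank_one TYPE('a)"
proof (rule stable_rank_oneI)
  fix a :: 'a and e :: real assume e: "0 < e"
  show "\<exists>y. invertible_elt y \<and> norm (y - a) < e"
  proof (cases "invertible_elt a")
    case True
    then show ?thesis using e by (intro exI[of _ a]) simp
  next
    case False
    have fin: "finite_cstar TYPE('a)"
      by (rule tracially_split_finite[OF split simple stable_rank_one_imp_finite[OF sr]])
    obtain x U V c c' where x: "norm (a - x) \<le> e / 2" and UV: "invertible_elt U" "invertible_elt V"
      and c: "cpos c" "c \<noteq> 0" "c'\<^sup>\<star> = c'" "c' * c = c" "c * c' = c"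
      "(U * x * V) * c' = 0" "c' * (U * x * V) = 0"
      using finite_simple_near_zero_divisor[OF fin simple False half_gt_zero[OF e]] by metis
    obtain U' V' where U': "U * U' = 1" "U' * U = 1" and V': "V * V' = 1" "V' * V = 1"
      using UV by (auto simp: invertible_elt_def)
    \<comment> \<open>Bounds the cost of undoing \<open>U\<close> and \<open>V\<close>; the summand
      1 keeps it positive.\<close>
    define q where "q = norm U' * norm V' + 1"
    have q: "0 < q" by (simp add: q_def add_nonneg_pos)
    obtain y where y: "invertible_elt y" "norm (y - U * x * V) < e / (2 * q)"
      using tracially_split_near_invertible[OF split sr c, of "e / (2 * q)"] e q by auto
    have "U' * (y - U * x * V) * V' = U' * y * V' - (U' * U) * x * (V * V')"
      by (simp only: right_diff_distrib left_diff_distrib mult.assoc)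
    then have "norm (U' * y * V' - x) = norm (U' * (y - U * x * V) * V')" using U' V' by simp
    also have "\<dots> \<le> norm U' * norm (y - U * x * V) * norm V'"
      by (rule order_trans[OF norm_mult_ineq mult_right_mono[OF norm_mult_ineq]]) simp
    also have "\<dots> = (norm U' * norm V') * norm (y - U * x * V)" by simp
    also have "\<dots> \<le> q * norm (y - U * x * V)" by (intro mult_right_mono) (simp_all add: q_def)
    also have "\<dots> < q * (e / (2 * q))" using y q by (intro mult_strict_left_mono)
    also have "\<dots> = e / 2" using q by simp
    finally have "norm (U' * y * V' - a) < e"
      using x norm_triangle_ineq[of "U' * y * V' - x" "x - a"] by (simp add: norm_minus_commute)
    moreover have "invertible_elt (U' * y * V')"
      using y U' V' by (intro invertible_elt_mult) (auto intro: invertible_eltI)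
    ultimately show ?thesis by blast
  qed
qed

theorem theorem2p11:
  fixes \<phi> :: "'a::unital_cstar_algebra \<Rightarrow> 'b::unital_cstar_algebra"
  assumes "separable_cstar TYPE('a)" and "separable_cstar TYPE('b)"
    and "simple_cstar TYPE('a)" and "simple_cstar TYPE('b)"
    and "tracially_sequentially_split \<phi>" and "\<phi> 1 = 1"
  shows "(finite_cstar TYPE('b) \<longrightarrow> finite_cstar TYPE('a)) \<and>
         (stable_rank_one TYPE('b) \<longrightarrow> stable_rank_one TYPE('a))"
  using assms tracially_split_finite tracially_split_stable_rank_one by blast

end
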